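(* Let $(\mathcal{C},\otimes,I)$ be a small symmetric monoidal category. For sequences of objects $\mathbf{X}=(X_0,X_1,\dots)$ and $\mathbf{Y}=(Y_0,Y_1,\dots)$ of $\mathcal{C}$, let $$\mathrm{iSeq}(\mathbf{X},\mathbf{Y}) := \sum_{(M_n)_{n\in\mathbb{N}}} \prod_{n=0}^{\infty}\mathcal{C}(M_{n-1}\otimes X_n,\ M_n\otimes Y_n),$$ where the sum ranges over all sequences $(M_0,M_1,\dots)$ of objects of $\mathcal{C}$ and $M_{-1}:=I$ (elements are "intensional sequences" $(f_n\colon M_{n-1}\otimes X_n\to M_n\otimes Y_n)_{n}$). Then $\mathrm{iSeq}$ is a fixpoint of the endofunctor $\Psi$ on $[(\mathcal{C}^{\mathbb{N}})^{op}\times\mathcal{C}^{\mathbb{N}},\mathbf{Set}]$ given by $$\Psi(T)(\mathbf{X},\mathbf{Y}) = \sum_{M\in\mathrm{Ob}(\mathcal{C})}\mathcal{C}(X_0,M\otimes Y_0)\times T(M\cdot\mathbf{X}^+,\mathbf{Y}^+),$$ i.e. $\mathrm{iSeq}(\mathbf{X},\mathbf{Y})\cong\sum_{M}\mathcal{C}(X_0,M\otimes Y_0)\times\mathrm{iSeq}(M\cdot\mathbf{X}^+,\mathbf{Y}^+)$ (by splitting off the first component), and it is the final such fixpoint (final $\Psi$-coalgebra). In other words, the set of intensional monoidal streams, defined as the final fixpoint of $\Psi$, is isomorphic to $\mathrm{iSeq}$.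
   Context: $\mathcal{C}^{\mathbb{N}}$ is the category whose objects are sequences $\mathbf{X}=(X_0,X_1,\dots)$ of objects of $\mathcal{C}$ and whose morphisms are sequences of morphisms $(f_n\colon X_n\to Y_n)_n$. For a sequence $\mathbf{X}$, its tail is $\mathbf{X}^+=(X_1,X_2,\dots)$; for an object $M$, $M\cdot\mathbf{X}=(M\otimes X_0,X_1,X_2,\dots)$, so $M\cdot\mathbf{X}^+=(M\otimes X_1,X_2,\dots)$. Associators and unitors are suppressed. *)

theory Defs
  imports Main "HOL-Library.FuncSet"
begin

section \<open>Categories, set-valued functors, natural transformations\<close>

record ('o, 'm) cat =
  Obj :: "'o set"
  Arr :: "'m set"
  Dom :: "'m \<Rightarrow> 'o"
  Cod :: "'m \<Rightarrow> 'o"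
  Ide :: "'o \<Rightarrow> 'm"
  Comp :: "'m \<Rightarrow> 'm \<Rightarrow> 'm"  (infixr \<open>\<cdot>\<index>\<close> 65)

definition hom :: "('o, 'm, 'z) cat_scheme \<Rightarrow> 'o \<Rightarrow> 'o \<Rightarrow> 'm set" where
  "hom C a b = {f \<in> Arr C. Dom C f = a \<and> Cod C f = b}"

locale category =
  fixes C :: "('o, 'm, 'z) cat_scheme" (structure)
  assumes Dom_Obj: "f \<in> Arr C \<Longrightarrow> Dom C f \<in> Obj C"
    and Cod_Obj: "f \<in> Arr C \<Longrightarrow> Cod C f \<in> Obj C"
    and Id_hom: "a \<in> Obj C \<Longrightarrow> Ide C a \<in> hom C a a"
    and Comp_hom: "\<lbrakk>f \<in> hom C a b; g \<in> hom C b c\<rbrakk> \<Longrightarrow> g \<cdot> f \<in> hom C a c"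
    and Id_left: "f \<in> hom C a b \<Longrightarrow> Ide C b \<cdot> f = f"
    and Id_right: "f \<in> hom C a b \<Longrightarrow> f \<cdot> Ide C a = f"
    and Comp_assoc: "\<lbrakk>f \<in> hom C a b; g \<in> hom C b c; h \<in> hom C c d\<rbrakk>
      \<Longrightarrow> (h \<cdot> g) \<cdot> f = h \<cdot> (g \<cdot> f)"

definition inverse_arr :: "('o, 'm, 'z) cat_scheme \<Rightarrow> 'm \<Rightarrow> 'm \<Rightarrow> bool" where
  "inverse_arr C f g \<longleftrightarrow> f \<in> Arr C \<and> g \<in> hom C (Cod C f) (Dom C f) \<and>
     g \<cdot>\<^bsub>C\<^esub> f = Ide C (Dom C f) \<and> f \<cdot>\<^bsub>C\<^esub> g = Ide C (Cod C f)"

definition iso_arr :: "('o, 'm, 'z) cat_scheme \<Rightarrow> 'm \<Rightarrow> bool" where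
  "iso_arr C f \<longleftrightarrow> (\<exists>g. inverse_arr C f g)"

definition inv_arr :: "('o, 'm, 'z) cat_scheme \<Rightarrow> 'm \<Rightarrow> 'm" where
  "inv_arr C f = (THE g. inverse_arr C f g)"

definition op_cat :: "('o, 'm, 'z) cat_scheme \<Rightarrow> ('o, 'm) cat" where
  "op_cat C = \<lparr>Obj = Obj C, Arr = Arr C, Dom = Cod C, Cod = Dom C, Ide = Ide C,
     Comp = (\<lambda>g f. f \<cdot>\<^bsub>C\<^esub> g)\<rparr>"

definition prod_cat ::
  "('o, 'm, 'z) cat_scheme \<Rightarrow> ('p, 'n, 'y) cat_scheme \<Rightarrow> ('o \<times> 'p, 'm \<times> 'n) cat" where
  "prod_cat C D = \<lparr>Obj = Obj C \<times> Obj D, Arr = Arr C \<times> Arr D,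
     Dom = map_prod (Dom C) (Dom D), Cod = map_prod (Cod C) (Cod D),
     Ide = map_prod (Ide C) (Ide D),
     Comp = (\<lambda>(g, g') (f, f'). (g \<cdot>\<^bsub>C\<^esub> f, g' \<cdot>\<^bsub>D\<^esub> f'))\<rparr>"

definition seq_cat :: "('o, 'm, 'z) cat_scheme \<Rightarrow> (nat \<Rightarrow> 'o, nat \<Rightarrow> 'm) cat" where
  "seq_cat C = \<lparr>Obj = {X. \<forall>n. X n \<in> Obj C}, Arr = {f. \<forall>n. f n \<in> Arr C},
     Dom = (\<lambda>f n. Dom C (f n)), Cod = (\<lambda>f n. Cod C (f n)), Ide = (\<lambda>X n. Ide C (X n)),
     Comp = (\<lambda>g f n. g n \<cdot>\<^bsub>C\<^esub> f n)\<rparr>"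

text \<open>Morphisms of sets are extensional functions, and a natural transformation is an extensional
  family of them, so that HOL equality is equality of morphisms in the functor category.
  The element type \<open>'e\<close> stands for the universe from which the sets are taken.\<close>

record ('o, 'm, 'e) set_fun =
  FObj :: "'o \<Rightarrow> 'e set"
  FArr :: "'m \<Rightarrow> 'e \<Rightarrow> 'e"

definition set_functor :: "('o, 'm, 'z) cat_scheme \<Rightarrow> ('o, 'm, 'e) set_fun \<Rightarrow> bool" where
  "set_functor D F \<longleftrightarrow>
     (\<forall>f\<in>Arr D. FArr F f \<in> FObj F (Dom D f) \<rightarrow>\<^sub>E FObj F (Cod D f)) \<and>
     (\<forall>a\<in>Obj D. FArr F (Ide D a) = (\<lambda>x\<in>FObj F a. x)) \<and>
     (\<forall>f\<in>Arr D. \<forall>g\<in>Arr D. Dom D g = Cod D f \<longrightarrow>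
        FArr F (g \<cdot>\<^bsub>D\<^esub> f) = compose (FObj F (Dom D f)) (FArr F g) (FArr F f))"

definition nat_trans :: "('o, 'm, 'z) cat_scheme \<Rightarrow> ('o, 'm, 'e) set_fun \<Rightarrow> ('o, 'm, 'f) set_fun
    \<Rightarrow> ('o \<Rightarrow> 'e \<Rightarrow> 'f) \<Rightarrow> bool" where
  "nat_trans D F G \<alpha> \<longleftrightarrow>
     \<alpha> \<in> (\<Pi>\<^sub>E a\<in>Obj D. FObj F a \<rightarrow>\<^sub>E FObj G a) \<and>
     (\<forall>f\<in>Arr D. compose (FObj F (Dom D f)) (\<alpha> (Cod D f)) (FArr F f) =
                compose (FObj F (Dom D f)) (FArr G f) (\<alpha> (Dom D f)))"

definition nat_id :: "('o, 'm, 'z) cat_scheme \<Rightarrow> ('o, 'm, 'e) set_fun \<Rightarrow> 'o \<Rightarrow> 'e \<Rightarrow> 'e" where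
  "nat_id D F = (\<lambda>a\<in>Obj D. \<lambda>x\<in>FObj F a. x)"

definition nat_comp :: "('o, 'm, 'z) cat_scheme \<Rightarrow> ('o, 'm, 'e) set_fun
    \<Rightarrow> ('o \<Rightarrow> 'f \<Rightarrow> 'g) \<Rightarrow> ('o \<Rightarrow> 'e \<Rightarrow> 'f) \<Rightarrow> 'o \<Rightarrow> 'e \<Rightarrow> 'g" where
  "nat_comp D F \<beta> \<alpha> = (\<lambda>a\<in>Obj D. compose (FObj F a) (\<beta> a) (\<alpha> a))"

definition nat_iso :: "('o, 'm, 'z) cat_scheme \<Rightarrow> ('o, 'm, 'e) set_fun \<Rightarrow> ('o, 'm, 'f) set_fun
    \<Rightarrow> ('o \<Rightarrow> 'e \<Rightarrow> 'f) \<Rightarrow> bool" where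
  "nat_iso D F G \<alpha> \<longleftrightarrow> nat_trans D F G \<alpha> \<and>
     (\<exists>\<beta>. nat_trans D G F \<beta> \<and>
        nat_comp D F \<beta> \<alpha> = nat_id D F \<and> nat_comp D G \<alpha> \<beta> = nat_id D G)"


section \<open>Symmetric monoidal categories\<close>

record ('o, 'm) smcat = "('o, 'm) cat" +
  TensO :: "'o \<Rightarrow> 'o \<Rightarrow> 'o"  (infixr \<open>\<otimes>\<index>\<close> 70)
  TensA :: "'m \<Rightarrow> 'm \<Rightarrow> 'm"  (infixr \<open>\<boxtimes>\<index>\<close> 70)
  Unit :: "'o"
  Assoc :: "'o \<Rightarrow> 'o \<Rightarrow> 'o \<Rightarrow> 'm"
  Lunit :: "'o \<Rightarrow> 'm"
  Runit :: "'o \<Rightarrow> 'm"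
  Braid :: "'o \<Rightarrow> 'o \<Rightarrow> 'm"

locale symmetric_monoidal_category = category C
  for C :: "('o, 'm, 'z) smcat_scheme" (structure) +
  assumes TensO_Obj: "\<lbrakk>a \<in> Obj C; b \<in> Obj C\<rbrakk> \<Longrightarrow> a \<otimes> b \<in> Obj C"
    and Unit_Obj: "Unit C \<in> Obj C"
    and TensA_hom: "\<lbrakk>f \<in> hom C a b; g \<in> hom C c d\<rbrakk> \<Longrightarrow> f \<boxtimes> g \<in> hom C (a \<otimes> c) (b \<otimes> d)"
    and TensA_Id: "\<lbrakk>a \<in> Obj C; b \<in> Obj C\<rbrakk> \<Longrightarrow> Ide C a \<boxtimes> Ide C b = Ide C (a \<otimes> b)"
    and TensA_Comp: "\<lbrakk>f \<in> hom C a b; g \<in> hom C b c; f' \<in> hom C a' b'; g' \<in> hom C b' c'\<rbrakk>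
      \<Longrightarrow> (g \<cdot> f) \<boxtimes> (g' \<cdot> f') = (g \<boxtimes> g') \<cdot> (f \<boxtimes> f')"
    and Assoc_hom: "\<lbrakk>a \<in> Obj C; b \<in> Obj C; c \<in> Obj C\<rbrakk>
      \<Longrightarrow> Assoc C a b c \<in> hom C ((a \<otimes> b) \<otimes> c) (a \<otimes> (b \<otimes> c))"
    and Assoc_iso: "\<lbrakk>a \<in> Obj C; b \<in> Obj C; c \<in> Obj C\<rbrakk> \<Longrightarrow> iso_arr C (Assoc C a b c)"
    and Assoc_nat: "\<lbrakk>f \<in> hom C a a'; g \<in> hom C b b'; h \<in> hom C c c'\<rbrakk>
      \<Longrightarrow> Assoc C a' b' c' \<cdot> ((f \<boxtimes> g) \<boxtimes> h) = (f \<boxtimes> (g \<boxtimes> h)) \<cdot> Assoc C a b c"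
    and Lunit_hom: "a \<in> Obj C \<Longrightarrow> Lunit C a \<in> hom C (Unit C \<otimes> a) a"
    and Lunit_iso: "a \<in> Obj C \<Longrightarrow> iso_arr C (Lunit C a)"
    and Lunit_nat: "f \<in> hom C a b \<Longrightarrow> Lunit C b \<cdot> (Ide C (Unit C) \<boxtimes> f) = f \<cdot> Lunit C a"
    and Runit_hom: "a \<in> Obj C \<Longrightarrow> Runit C a \<in> hom C (a \<otimes> Unit C) a"
    and Runit_iso: "a \<in> Obj C \<Longrightarrow> iso_arr C (Runit C a)"
    and Runit_nat: "f \<in> hom C a b \<Longrightarrow> Runit C b \<cdot> (f \<boxtimes> Ide C (Unit C)) = f \<cdot> Runit C a"
    and Braid_hom: "\<lbrakk>a \<in> Obj C; b \<in> Obj C\<rbrakk> \<Longrightarrow> Braid C a b \<in> hom C (a \<otimes> b) (b \<otimes> a)"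
    and Braid_nat: "\<lbrakk>f \<in> hom C a a'; g \<in> hom C b b'\<rbrakk>
      \<Longrightarrow> Braid C a' b' \<cdot> (f \<boxtimes> g) = (g \<boxtimes> f) \<cdot> Braid C a b"
    and pentagon: "\<lbrakk>a \<in> Obj C; b \<in> Obj C; c \<in> Obj C; d \<in> Obj C\<rbrakk>
      \<Longrightarrow> Assoc C a b (c \<otimes> d) \<cdot> Assoc C (a \<otimes> b) c d =
          (Ide C a \<boxtimes> Assoc C b c d) \<cdot> Assoc C a (b \<otimes> c) d \<cdot> (Assoc C a b c \<boxtimes> Ide C d)"
    and triangle: "\<lbrakk>a \<in> Obj C; b \<in> Obj C\<rbrakk>
      \<Longrightarrow> (Ide C a \<boxtimes> Lunit C b) \<cdot> Assoc C a (Unit C) b = Runit C a \<boxtimes> Ide C b"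
    and hexagon: "\<lbrakk>a \<in> Obj C; b \<in> Obj C; c \<in> Obj C\<rbrakk>
      \<Longrightarrow> Assoc C b c a \<cdot> Braid C a (b \<otimes> c) \<cdot> Assoc C a b c =
          (Ide C b \<boxtimes> Braid C a c) \<cdot> Assoc C b a c \<cdot> (Braid C a b \<boxtimes> Ide C c)"
    and symmetry: "\<lbrakk>a \<in> Obj C; b \<in> Obj C\<rbrakk> \<Longrightarrow> Braid C b a \<cdot> Braid C a b = Ide C (a \<otimes> b)"


section \<open>The endofunctor \<open>\<Psi>\<close> and its coalgebras\<close>

abbreviation bi_seq_cat ::
  "('o, 'm, 'z) cat_scheme \<Rightarrow> ((nat \<Rightarrow> 'o) \<times> (nat \<Rightarrow> 'o), (nat \<Rightarrow> 'm) \<times> (nat \<Rightarrow> 'm)) cat" where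
  "bi_seq_cat C \<equiv> prod_cat (op_cat (seq_cat C)) (seq_cat C)"

type_synonym ('o, 'm, 'e) seq_profunctor =
  "((nat \<Rightarrow> 'o) \<times> (nat \<Rightarrow> 'o), (nat \<Rightarrow> 'm) \<times> (nat \<Rightarrow> 'm), 'e) set_fun"

definition tail :: "(nat \<Rightarrow> 'a) \<Rightarrow> nat \<Rightarrow> 'a" where
  "tail X = (\<lambda>n. X (Suc n))"

definition actO :: "('o, 'm, 'z) smcat_scheme \<Rightarrow> 'o \<Rightarrow> (nat \<Rightarrow> 'o) \<Rightarrow> nat \<Rightarrow> 'o" where
  "actO C M X = X(0 := M \<otimes>\<^bsub>C\<^esub> X 0)"

definition actA :: "('o, 'm, 'z) smcat_scheme \<Rightarrow> 'o \<Rightarrow> (nat \<Rightarrow> 'm) \<Rightarrow> nat \<Rightarrow> 'm" where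
  "actA C M u = u(0 := Ide C M \<boxtimes>\<^bsub>C\<^esub> u 0)"

text \<open>An arrow \<open>(u, v)\<close> of \<^term>\<open>bi_seq_cat C\<close> is a pair of sequences of arrows
  \<open>u\<^sub>n : X'\<^sub>n \<rightarrow> X\<^sub>n\<close> and \<open>v\<^sub>n : Y\<^sub>n \<rightarrow> Y'\<^sub>n\<close>, with domain \<open>(X, Y)\<close> and codomain \<open>(X', Y')\<close>.\<close>

definition Psi_obj :: "('o, 'm, 'z) smcat_scheme \<Rightarrow> ('o, 'm, 'e) seq_profunctor
    \<Rightarrow> (nat \<Rightarrow> 'o) \<times> (nat \<Rightarrow> 'o) \<Rightarrow> ('o \<times> 'm \<times> 'e) set" where
  "Psi_obj C T = (\<lambda>(X, Y). SIGMA M:Obj C.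
     hom C (X 0) (M \<otimes>\<^bsub>C\<^esub> Y 0) \<times> FObj T (actO C M (tail X), tail Y))"

definition Psi :: "('o, 'm, 'z) smcat_scheme \<Rightarrow> ('o, 'm, 'e) seq_profunctor
    \<Rightarrow> ('o, 'm, 'o \<times> 'm \<times> 'e) seq_profunctor" where
  "Psi C T = \<lparr>FObj = Psi_obj C T,
     FArr = (\<lambda>(u, v). \<lambda>(M, f, t)\<in>Psi_obj C T (Dom (bi_seq_cat C) (u, v)).
       (M, (Ide C M \<boxtimes>\<^bsub>C\<^esub> v 0) \<cdot>\<^bsub>C\<^esub> f \<cdot>\<^bsub>C\<^esub> u 0, FArr T (actA C M (tail u), tail v) t))\<rparr>"

definition Psi_map :: "('o, 'm, 'z) smcat_scheme \<Rightarrow> ('o, 'm, 'e) seq_profunctor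
    \<Rightarrow> ((nat \<Rightarrow> 'o) \<times> (nat \<Rightarrow> 'o) \<Rightarrow> 'e \<Rightarrow> 'f)
    \<Rightarrow> (nat \<Rightarrow> 'o) \<times> (nat \<Rightarrow> 'o) \<Rightarrow> 'o \<times> 'm \<times> 'e \<Rightarrow> 'o \<times> 'm \<times> 'f" where
  "Psi_map C T \<alpha> = (\<lambda>(X, Y)\<in>Obj (bi_seq_cat C). \<lambda>(M, f, t)\<in>Psi_obj C T (X, Y).
     (M, f, \<alpha> (actO C M (tail X), tail Y) t))"

definition Psi_coalgebra :: "('o, 'm, 'z) smcat_scheme \<Rightarrow> ('o, 'm, 'e) seq_profunctor
    \<Rightarrow> ((nat \<Rightarrow> 'o) \<times> (nat \<Rightarrow> 'o) \<Rightarrow> 'e \<Rightarrow> 'o \<times> 'm \<times> 'e) \<Rightarrow> bool" where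
  "Psi_coalgebra C T \<tau> \<longleftrightarrow>
     set_functor (bi_seq_cat C) T \<and> nat_trans (bi_seq_cat C) T (Psi C T) \<tau>"

definition Psi_fixpoint :: "('o, 'm, 'z) smcat_scheme \<Rightarrow> ('o, 'm, 'e) seq_profunctor
    \<Rightarrow> ((nat \<Rightarrow> 'o) \<times> (nat \<Rightarrow> 'o) \<Rightarrow> 'e \<Rightarrow> 'o \<times> 'm \<times> 'e) \<Rightarrow> bool" where
  "Psi_fixpoint C T \<tau> \<longleftrightarrow>
     set_functor (bi_seq_cat C) T \<and> nat_iso (bi_seq_cat C) T (Psi C T) \<tau>"

definition Psi_coalgebra_hom :: "('o, 'm, 'z) smcat_scheme
    \<Rightarrow> ('o, 'm, 'e) seq_profunctor \<Rightarrow> ((nat \<Rightarrow> 'o) \<times> (nat \<Rightarrow> 'o) \<Rightarrow> 'e \<Rightarrow> 'o \<times> 'm \<times> 'e)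
    \<Rightarrow> ('o, 'm, 'f) seq_profunctor \<Rightarrow> ((nat \<Rightarrow> 'o) \<times> (nat \<Rightarrow> 'o) \<Rightarrow> 'f \<Rightarrow> 'o \<times> 'm \<times> 'f)
    \<Rightarrow> ((nat \<Rightarrow> 'o) \<times> (nat \<Rightarrow> 'o) \<Rightarrow> 'e \<Rightarrow> 'f) \<Rightarrow> bool" where
  "Psi_coalgebra_hom C T \<tau> S \<sigma> h \<longleftrightarrow> nat_trans (bi_seq_cat C) T S h \<and>
     nat_comp (bi_seq_cat C) T \<sigma> h = nat_comp (bi_seq_cat C) T (Psi_map C T h) \<tau>"

text \<open>HOL cannot quantify over types inside a formula: the type argument fixes the universe
  \<open>'e\<close> of the competing coalgebras.\<close>

definition final_Psi_coalgebra :: "'e itself \<Rightarrow> ('o, 'm, 'z) smcat_scheme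
    \<Rightarrow> ('o, 'm, 's) seq_profunctor \<Rightarrow> ((nat \<Rightarrow> 'o) \<times> (nat \<Rightarrow> 'o) \<Rightarrow> 's \<Rightarrow> 'o \<times> 'm \<times> 's)
    \<Rightarrow> bool" where
  "final_Psi_coalgebra (_ :: 'e itself) C S \<sigma> \<longleftrightarrow> Psi_coalgebra C S \<sigma> \<and>
     (\<forall>(T :: ('o, 'm, 'e) seq_profunctor) \<tau>.
        Psi_coalgebra C T \<tau> \<longrightarrow> (\<exists>!h. Psi_coalgebra_hom C T \<tau> S \<sigma> h))"


section \<open>Intensional sequences\<close>

definition prev :: "('o, 'm, 'z) smcat_scheme \<Rightarrow> (nat \<Rightarrow> 'o) \<Rightarrow> nat \<Rightarrow> 'o" where
  "prev C M n = (case n of 0 \<Rightarrow> Unit C | Suc k \<Rightarrow> M k)"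

definition iSeq_obj :: "('o, 'm, 'z) smcat_scheme \<Rightarrow> (nat \<Rightarrow> 'o) \<times> (nat \<Rightarrow> 'o)
    \<Rightarrow> ((nat \<Rightarrow> 'o) \<times> (nat \<Rightarrow> 'm)) set" where
  "iSeq_obj C = (\<lambda>(X, Y). SIGMA M:Obj (seq_cat C).
     \<Pi> n\<in>UNIV. hom C (prev C M n \<otimes>\<^bsub>C\<^esub> X n) (M n \<otimes>\<^bsub>C\<^esub> Y n))"

definition iSeq :: "('o, 'm, 'z) smcat_scheme
    \<Rightarrow> ('o, 'm, (nat \<Rightarrow> 'o) \<times> (nat \<Rightarrow> 'm)) seq_profunctor" where
  "iSeq C = \<lparr>FObj = iSeq_obj C,
     FArr = (\<lambda>(u, v). \<lambda>(M, f)\<in>iSeq_obj C (Dom (bi_seq_cat C) (u, v)).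
       (M, \<lambda>n. (Ide C (M n) \<boxtimes>\<^bsub>C\<^esub> v n) \<cdot>\<^bsub>C\<^esub> f n \<cdot>\<^bsub>C\<^esub> (Ide C (prev C M n) \<boxtimes>\<^bsub>C\<^esub> u n)))\<rparr>"

text \<open>Splitting off the first component. Since \<open>M\<^sub>-\<^sub>1\<close> is the unit, the left unitor mediates between
  \<open>I \<otimes> X\<^sub>0\<close> and \<open>X\<^sub>0\<close> for the head, and between \<open>M\<^sub>0 \<otimes> X\<^sub>1\<close> and \<open>I \<otimes> (M\<^sub>0 \<otimes> X\<^sub>1)\<close> for the tail.\<close>

definition iSeq_split :: "('o, 'm, 'z) smcat_scheme \<Rightarrow> (nat \<Rightarrow> 'o) \<times> (nat \<Rightarrow> 'o)
    \<Rightarrow> (nat \<Rightarrow> 'o) \<times> (nat \<Rightarrow> 'm) \<Rightarrow> 'o \<times> 'm \<times> (nat \<Rightarrow> 'o) \<times> (nat \<Rightarrow> 'm)" where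
  "iSeq_split C = (\<lambda>(X, Y)\<in>Obj (bi_seq_cat C). \<lambda>(M, f)\<in>iSeq_obj C (X, Y).
     (M 0, f 0 \<cdot>\<^bsub>C\<^esub> inv_arr C (Lunit C (X 0)),
      tail M, (tail f)(0 := f 1 \<cdot>\<^bsub>C\<^esub> Lunit C (M 0 \<otimes>\<^bsub>C\<^esub> X 1))))"


section \<open>\<open>\<Psi>\<close> is an endofunctor and \<open>iSeq\<close> is a functor\<close>

lemma hom_iff: "f \<in> hom C a b \<longleftrightarrow> f \<in> Arr C \<and> Dom C f = a \<and> Cod C f = b"
  by (simp add: hom_def)

lemma bi_seq_simps:
  "Obj (bi_seq_cat C) = {X. \<forall>n. X n \<in> Obj C} \<times> {X. \<forall>n. X n \<in> Obj C}"
  "Arr (bi_seq_cat C) = {X. \<forall>n. X n \<in> Arr C} \<times> {X. \<forall>n. X n \<in> Arr C}"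
  "Dom (bi_seq_cat C) (u, v) = ((\<lambda>n. Cod C (u n)), (\<lambda>n. Dom C (v n)))"
  "Cod (bi_seq_cat C) (u, v) = ((\<lambda>n. Dom C (u n)), (\<lambda>n. Cod C (v n)))"
  "Ide (bi_seq_cat C) (X, Y) = ((\<lambda>n. Ide C (X n)), (\<lambda>n. Ide C (Y n)))"
  "Comp (bi_seq_cat C) (u', v') (u, v) = ((\<lambda>n. Comp C (u n) (u' n)), (\<lambda>n. Comp C (v' n) (v n)))"
  by (simp_all add: prod_cat_def op_cat_def seq_cat_def)

lemma category_seq_cat: "category C \<Longrightarrow> category (seq_cat C)"
  unfolding category_def seq_cat_def hom_def by (auto simp: fun_eq_iff)

lemma category_op_cat: "category C \<Longrightarrow> category (op_cat C)"
  unfolding category_def op_cat_def hom_def by auto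

lemma category_prod_cat: "\<lbrakk>category C; category D\<rbrakk> \<Longrightarrow> category (prod_cat C D)"
  unfolding category_def prod_cat_def hom_def by (auto split: prod.splits)

lemma set_functor_iff:
  "set_functor D F \<longleftrightarrow>
     (\<forall>f\<in>Arr D. FArr F f \<in> extensional (FObj F (Dom D f))) \<and>
     (\<forall>f\<in>Arr D. \<forall>x\<in>FObj F (Dom D f). FArr F f x \<in> FObj F (Cod D f)) \<and>
     (\<forall>a\<in>Obj D. FArr F (Ide D a) = (\<lambda>x\<in>FObj F a. x)) \<and>
     (\<forall>f\<in>Arr D. \<forall>g\<in>Arr D. Dom D g = Cod D f \<longrightarrow>
        FArr F (g \<cdot>\<^bsub>D\<^esub> f) = (\<lambda>x\<in>FObj F (Dom D f). FArr F g (FArr F f x)))"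
  unfolding set_functor_def compose_def by (auto simp: PiE_iff)

lemma ext_eq: "f \<in> extensional A \<Longrightarrow> (\<And>x. x \<in> A \<Longrightarrow> f x = g x) \<Longrightarrow> f = restrict g A"
  by (auto simp: extensional_def restrict_def fun_eq_iff)

lemma nat_trans_iff:
  "nat_trans D F G \<alpha> \<longleftrightarrow> \<alpha> \<in> extensional (Obj D) \<and>
     (\<forall>a\<in>Obj D. \<alpha> a \<in> extensional (FObj F a)) \<and>
     (\<forall>a\<in>Obj D. \<forall>x\<in>FObj F a. \<alpha> a x \<in> FObj G a) \<and>
     (\<forall>f\<in>Arr D. \<forall>x\<in>FObj F (Dom D f). \<alpha> (Cod D f) (FArr F f x) = FArr G f (\<alpha> (Dom D f) x))"
  unfolding nat_trans_def compose_def by (auto simp: PiE_iff restrict_def fun_eq_iff)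

context symmetric_monoidal_category begin

lemmas homs = Id_hom Comp_hom TensA_hom TensO_Obj Unit_Obj

lemma hom_Obj: "f \<in> hom C a b \<Longrightarrow> a \<in> Obj C" "f \<in> hom C a b \<Longrightarrow> b \<in> Obj C"
  using Dom_Obj Cod_Obj by (auto simp: hom_def)

lemma Arr_hom: "f \<in> Arr C \<Longrightarrow> f \<in> hom C (Dom C f) (Cod C f)"
  by (simp add: hom_def)

lemma DC: "f \<in> hom C a b \<Longrightarrow> Dom C f = a" "f \<in> hom C a b \<Longrightarrow> Cod C f = b"
   "f \<in> hom C a b \<Longrightarrow> f \<in> Arr C"
  by (auto simp: hom_def)

lemma wh: "\<lbrakk>M \<in> Obj C; f \<in> Arr C\<rbrakk> \<Longrightarrow> Ide C M \<boxtimes> f \<in> hom C (M \<otimes> Dom C f) (M \<otimes> Cod C f)"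
  by (intro TensA_hom Id_hom Arr_hom)

lemma wh_Comp: "\<lbrakk>M \<in> Obj C; f \<in> hom C a b; g \<in> hom C b c\<rbrakk>
   \<Longrightarrow> Ide C M \<boxtimes> (g \<cdot> f) = (Ide C M \<boxtimes> g) \<cdot> (Ide C M \<boxtimes> f)"
  using TensA_Comp[of "Ide C M" M M "Ide C M" M f a b g c] Id_hom Id_left by metis

lemma five:
  assumes u': "u' \<in> hom C a a1" and u: "u \<in> hom C a1 a2" and f: "f \<in> hom C a2 b" and v: "v \<in> hom C b b1" and v': "v' \<in> hom C b1 b2"
  shows "(v' \<cdot> v) \<cdot> f \<cdot> (u \<cdot> u') = v' \<cdot> (v \<cdot> f \<cdot> u) \<cdot> u'"
  using Comp_assoc[OF Comp_hom[OF Comp_hom[OF u' u] f] v v'] Comp_assoc[OF u' Comp_hom[OF u f] v] Comp_assoc[OF u' u f]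
  by simp

lemma act_seq: 
  "actO C M (tail X) n = (if n = 0 then M \<otimes> X 1 else X (Suc n))"
  "actA C M (tail u) n = (if n = 0 then Ide C M \<boxtimes> u 1 else u (Suc n))"
  by (auto simp: actO_def actA_def tail_def)

lemma actA_DC: "\<lbrakk>M \<in> Obj C; \<And>n. u n \<in> Arr C\<rbrakk> \<Longrightarrow> actA C M (tail u) n \<in> hom C (actO C M (tail (\<lambda>n. Dom C (u n))) n) (actO C M (tail (\<lambda>n. Cod C (u n))) n)"
  using wh[of M "u (Suc 0)"] by (auto simp: act_seq hom_iff)

lemma act_Id: "\<lbrakk>M \<in> Obj C; \<And>n. X n \<in> Obj C\<rbrakk> \<Longrightarrow> actA C M (tail (\<lambda>n. Ide C (X n))) = (\<lambda>n. Ide C (actO C M (tail X) n))"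
  by (auto simp: act_seq fun_eq_iff TensA_Id)

lemma act_Comp: "\<lbrakk>M \<in> Obj C; \<And>n. u n \<in> Arr C; \<And>n. u' n \<in> Arr C; \<And>n. Dom C (u n) = Cod C (u' n)\<rbrakk>
  \<Longrightarrow> actA C M (tail (\<lambda>n. u n \<cdot> u' n)) = (\<lambda>n. actA C M (tail u) n \<cdot> actA C M (tail u') n)"
  by (auto simp: act_seq fun_eq_iff) (metis Arr_hom wh_Comp)

lemma act_Obj: "\<lbrakk>(X,Y) \<in> Obj (bi_seq_cat C); M \<in> Obj C\<rbrakk> \<Longrightarrow> (actO C M (tail X), tail Y) \<in> Obj (bi_seq_cat C)"
  by (auto simp: bi_seq_simps act_seq TensO_Obj) (auto simp: tail_def)

lemma Psi_functor:
  assumes "set_functor (bi_seq_cat C) T"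
  shows "set_functor (bi_seq_cat C) (Psi C T)"
proof -
  note T = assms[unfolded set_functor_iff]
  have Tin: "FArr T (u,v) x \<in> FObj T (X',Y')" if "\<And>n. u n \<in> hom C (X' n) (X n)" "\<And>n. v n \<in> hom C (Y n) (Y' n)" "x \<in> FObj T (X,Y)" for u v X X' Y Y' x
  proof -
    have "(\<lambda>n. Dom C (u n)) = X'" "(\<lambda>n. Cod C (u n)) = X" "(\<lambda>n. Dom C (v n)) = Y" "(\<lambda>n. Cod C (v n)) = Y'"
      using that by (auto simp: fun_eq_iff hom_iff)
    then have "Dom (bi_seq_cat C) (u,v) = (X,Y)" "Cod (bi_seq_cat C) (u,v) = (X',Y')" by (simp_all add: bi_seq_simps)
    moreover have "(u,v) \<in> Arr (bi_seq_cat C)" using that by (auto simp: bi_seq_simps hom_iff)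
    ultimately show ?thesis using T that(3) by metis
  qed
  show ?thesis
    unfolding set_functor_iff
  proof (intro conjI ballI impI)
    fix f x assume f: "f \<in> Arr (bi_seq_cat C)" and x: "x \<in> FObj (Psi C T) (Dom (bi_seq_cat C) f)"
    obtain u v where uv: "f = (u,v)" by (cases f)
    have a: "u n \<in> Arr C" "v n \<in> Arr C" for n using f by (auto simp: uv bi_seq_simps)
    obtain M g t where x': "x = (M,g,t)" by (cases x)
    have x2: "M \<in> Obj C" "g \<in> hom C (Cod C (u 0)) (M \<otimes> Dom C (v 0))"
       "t \<in> FObj T (actO C M (tail (\<lambda>n. Cod C (u n))), tail (\<lambda>n. Dom C (v n)))"
      using x by (auto simp: uv x' Psi_def Psi_obj_def bi_seq_simps)
    have "(Ide C M \<boxtimes> v 0) \<cdot> g \<cdot> u 0 \<in> hom C (Dom C (u 0)) (M \<otimes> Cod C (v 0))"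
      by (rule Comp_hom[OF Comp_hom[OF Arr_hom] wh]) (use a x2 in auto)
    moreover have "FArr T (actA C M (tail u), tail v) t \<in> FObj T (actO C M (tail (\<lambda>n. Dom C (u n))), tail (\<lambda>n. Cod C (v n)))"
      by (rule Tin[OF actA_DC _ x2(3)]) (use a x2 in \<open>auto simp: tail_def hom_iff\<close>)
    ultimately show "FArr (Psi C T) f x \<in> FObj (Psi C T) (Cod (bi_seq_cat C) f)"
      using x x2 by (simp add: uv x' Psi_def Psi_obj_def bi_seq_simps)
  next
    fix f assume "f \<in> Arr (bi_seq_cat C)" 
    show "FArr (Psi C T) f \<in> extensional (FObj (Psi C T) (Dom (bi_seq_cat C) f))"
      by (cases f) (simp add: Psi_def)
  next
    fix a assume a: "a \<in> Obj (bi_seq_cat C)"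
    obtain X Y where XY: "a = (X,Y)" by (cases a)
    have o: "X n \<in> Obj C" "Y n \<in> Obj C" for n using a by (auto simp: XY bi_seq_simps)
    have d: "(\<lambda>n. Dom C (Ide C (X n))) = X" "(\<lambda>n. Cod C (Ide C (X n))) = X"
       "(\<lambda>n. Dom C (Ide C (Y n))) = Y" "(\<lambda>n. Cod C (Ide C (Y n))) = Y"
       using Id_hom o by (auto simp: hom_iff)
    have "(M, (Ide C M \<boxtimes> Ide C (Y 0)) \<cdot> f \<cdot> Ide C (X 0), FArr T (actA C M (tail (\<lambda>n. Ide C (X n))), tail (\<lambda>n. Ide C (Y n))) t) = (M,f,t)"
      if "(M,f,t) \<in> Psi_obj C T (X,Y)" for M f t
    proof -
      have f: "M \<in> Obj C" "f \<in> hom C (X 0) (M \<otimes> Y 0)" "t \<in> FObj T (actO C M (tail X), tail Y)"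
        using that by (auto simp: Psi_obj_def)
      have 1: "(Ide C M \<boxtimes> Ide C (Y 0)) \<cdot> f \<cdot> Ide C (X 0) = f"
        using f o TensA_Id Id_left Id_right by metis
      have "FArr T (Ide (bi_seq_cat C) (actO C M (tail X), tail Y)) t = t"
        using T act_Obj[OF a[unfolded XY] f(1)] f(3) by (metis (no_types, lifting) restrict_apply')
      then show ?thesis using 1 act_Id[OF f(1), of X] o 
        by (simp add: bi_seq_simps tail_def)
    qed
    then show "FArr (Psi C T) (Ide (bi_seq_cat C) a) = (\<lambda>x\<in>FObj (Psi C T) a. x)"
      by (auto simp: XY Psi_def bi_seq_simps d intro!: restrict_ext)
  next
    fix f g assume f: "f \<in> Arr (bi_seq_cat C)" and g: "g \<in> Arr (bi_seq_cat C)" and gf: "Dom (bi_seq_cat C) g = Cod (bi_seq_cat C) f"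
    obtain u v where uv: "f = (u,v)" by (cases f)
    obtain u' v' where uv': "g = (u',v')" by (cases g)
    have a: "u n \<in> Arr C" "v n \<in> Arr C" "u' n \<in> Arr C" "v' n \<in> Arr C" 
        "Dom C (u n) = Cod C (u' n)" "Dom C (v' n) = Cod C (v n)" for n 
      using f g gf by (auto simp: uv uv' bi_seq_simps fun_eq_iff)
    have "FArr (Psi C T) (g \<cdot>\<^bsub>bi_seq_cat C\<^esub> f) x = FArr (Psi C T) g (FArr (Psi C T) f x)"
      if x: "x \<in> FObj (Psi C T) (Dom (bi_seq_cat C) f)" for x
    proof -
      obtain M h t where x': "x = (M,h,t)" by (cases x)
      have x2: "M \<in> Obj C" "h \<in> hom C (Cod C (u 0)) (M \<otimes> Dom C (v 0))"
         "t \<in> FObj T (actO C M (tail (\<lambda>n. Cod C (u n))), tail (\<lambda>n. Dom C (v n)))"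
        using x by (auto simp: uv x' Psi_def Psi_obj_def bi_seq_simps)
      have k: "(Ide C M \<boxtimes> v 0) \<cdot> h \<cdot> u 0 \<in> hom C (Dom C (u 0)) (M \<otimes> Cod C (v 0))"
        by (rule Comp_hom[OF Comp_hom[OF Arr_hom] wh]) (use a x2 in auto)
      have k2: "FArr T (actA C M (tail u), tail v) t \<in> FObj T (actO C M (tail (\<lambda>n. Dom C (u n))), tail (\<lambda>n. Cod C (v n)))"
        by (rule Tin[OF actA_DC _ x2(3)]) (use a x2 in \<open>auto simp: tail_def hom_iff\<close>)
      have "Ide C M \<boxtimes> (v' 0 \<cdot> v 0) = (Ide C M \<boxtimes> v' 0) \<cdot> (Ide C M \<boxtimes> v 0)"
        using a x2 wh_Comp Arr_hom by metis
      moreover have "((Ide C M \<boxtimes> v' 0) \<cdot> (Ide C M \<boxtimes> v 0)) \<cdot> h \<cdot> (u 0 \<cdot> u' 0) = (Ide C M \<boxtimes> v' 0) \<cdot> ((Ide C M \<boxtimes> v 0) \<cdot> h \<cdot> u 0) \<cdot> u' 0"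
        using five[OF Arr_hom[OF a(3)[of 0]] Arr_hom[OF a(1)[of 0], unfolded a(5)] x2(2) wh[OF x2(1) a(2)[of 0]] wh[OF x2(1) a(4)[of 0], unfolded a(6)]] .
      moreover have "FArr T (actA C M (tail (\<lambda>n. u n \<cdot> u' n)), tail (\<lambda>n. v' n \<cdot> v n)) t = FArr T (actA C M (tail u'), tail v') (FArr T (actA C M (tail u), tail v) t)"
      proof -
        have *: "FArr T (Comp (bi_seq_cat C) p q) = (\<lambda>x\<in>FObj T (Dom (bi_seq_cat C) q). FArr T p (FArr T q x))" if "q \<in> Arr (bi_seq_cat C)" "p \<in> Arr (bi_seq_cat C)" "Dom (bi_seq_cat C) p = Cod (bi_seq_cat C) q" for p q
          using T that by blast
        have h: "actA C M (tail u) n \<in> hom C (actO C M (tail (\<lambda>n. Dom C (u n))) n) (actO C M (tail (\<lambda>n. Cod C (u n))) n)"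
          "actA C M (tail u') n \<in> hom C (actO C M (tail (\<lambda>n. Dom C (u' n))) n) (actO C M (tail (\<lambda>n. Cod C (u' n))) n)" for n
          by (rule actA_DC[OF x2(1) a(1)]) (rule actA_DC[OF x2(1) a(3)])
        note h' = h[unfolded hom_iff]
        show ?thesis using *[of "(actA C M (tail u), tail v)" "(actA C M (tail u'), tail v')"] h' x2 a
         by (simp add: bi_seq_simps act_Comp) (simp add: tail_def)
      qed
      moreover have c: "Cod C (u n \<cdot> u' n) = Cod C (u n)" "Dom C (v' n \<cdot> v n) = Dom C (v n)" for n
        using a Arr_hom Comp_hom DC by metis+
      ultimately show ?thesis using x x2 a k k2 
        by (simp add: uv uv' x' Psi_def Psi_obj_def bi_seq_simps)
    qed
    moreover have "Dom (bi_seq_cat C) (Comp (bi_seq_cat C) g f) = Dom (bi_seq_cat C) f"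
    proof -
      have c: "Cod C (u n \<cdot> u' n) = Cod C (u n)" "Dom C (v' n \<cdot> v n) = Dom C (v n)" for n
        using a Arr_hom Comp_hom DC by metis+
      then show ?thesis by (simp add: uv uv' bi_seq_simps)
    qed
    moreover have "FArr (Psi C T) f \<in> extensional (FObj (Psi C T) (Dom (bi_seq_cat C) f))" for f
      by (cases f) (simp add: Psi_def)
    ultimately show "FArr (Psi C T) (Comp (bi_seq_cat C) g f) = (\<lambda>x\<in>FObj (Psi C T) (Dom (bi_seq_cat C) f). FArr (Psi C T) g (FArr (Psi C T) f x))"
      by (intro ext_eq) metis+
  qed
qed

lemma Psi_map_nat_trans:
  assumes Tf: "set_functor (bi_seq_cat C) T" and \<alpha>: "nat_trans (bi_seq_cat C) T S \<alpha>"
  shows "nat_trans (bi_seq_cat C) (Psi C T) (Psi C S) (Psi_map C T \<alpha>)"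
  unfolding nat_trans_iff
proof (intro conjI ballI)
  note A = \<alpha>[unfolded nat_trans_iff]
  show "Psi_map C T \<alpha> \<in> extensional (Obj (bi_seq_cat C))" by (simp add: Psi_map_def)
  show "Psi_map C T \<alpha> a \<in> extensional (FObj (Psi C T) a)" if "a \<in> Obj (bi_seq_cat C)" for a
    using that by (cases a) (simp add: Psi_map_def Psi_def)
  show "Psi_map C T \<alpha> a x \<in> FObj (Psi C S) a" if "a \<in> Obj (bi_seq_cat C)" "x \<in> FObj (Psi C T) a" for a x
    using that A act_Obj by (cases a; cases x) (auto simp: Psi_map_def Psi_def Psi_obj_def)
  fix f x assume f: "f \<in> Arr (bi_seq_cat C)" and x: "x \<in> FObj (Psi C T) (Dom (bi_seq_cat C) f)"
  show "Psi_map C T \<alpha> (Cod (bi_seq_cat C) f) (FArr (Psi C T) f x) = FArr (Psi C S) f (Psi_map C T \<alpha> (Dom (bi_seq_cat C) f) x)"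
  proof -
    obtain u v where uv: "f = (u,v)" by (cases f)
    have a: "u n \<in> Arr C" "v n \<in> Arr C" for n using f by (auto simp: uv bi_seq_simps)
    obtain M g t where x': "x = (M,g,t)" by (cases x)
    have x2: "M \<in> Obj C" "g \<in> hom C (Cod C (u 0)) (M \<otimes> Dom C (v 0))"
       "t \<in> FObj T (actO C M (tail (\<lambda>n. Cod C (u n))), tail (\<lambda>n. Dom C (v n)))"
      using x by (auto simp: uv x' Psi_def Psi_obj_def bi_seq_simps)
    have k: "(Ide C M \<boxtimes> v 0) \<cdot> g \<cdot> u 0 \<in> hom C (Dom C (u 0)) (M \<otimes> Cod C (v 0))"
      by (rule Comp_hom[OF Comp_hom[OF Arr_hom] wh]) (use a x2 in auto)
    have h: "actA C M (tail u) n \<in> hom C (actO C M (tail (\<lambda>n. Dom C (u n))) n) (actO C M (tail (\<lambda>n. Cod C (u n))) n)" for n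
      using a x2 actA_DC by auto
    note h' = h[unfolded hom_iff]
    let ?p = "(actA C M (tail u), tail v)"
    have p: "?p \<in> Arr (bi_seq_cat C)" 
         "Dom (bi_seq_cat C) ?p = (actO C M (tail (\<lambda>n. Cod C (u n))), tail (\<lambda>n. Dom C (v n)))"
         "Cod (bi_seq_cat C) ?p = (actO C M (tail (\<lambda>n. Dom C (u n))), tail (\<lambda>n. Cod C (v n)))"
      using h' a by (simp_all add: bi_seq_simps) (simp_all add: tail_def)
    have t: "t \<in> FObj T (Dom (bi_seq_cat C) ?p)" using p x2 by simp
    have d: "Dom (bi_seq_cat C) ?p \<in> Obj (bi_seq_cat C)" unfolding p(2)
      by (rule act_Obj) (use a x2 Cod_Obj Dom_Obj in \<open>auto simp: bi_seq_simps\<close>)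
    have q: "FArr T ?p t \<in> FObj T (Cod (bi_seq_cat C) ?p)" "\<alpha> (Cod (bi_seq_cat C) ?p) (FArr T ?p t) = FArr S ?p (\<alpha> (Dom (bi_seq_cat C) ?p) t)"
      "\<alpha> (Dom (bi_seq_cat C) ?p) t \<in> FObj S (Dom (bi_seq_cat C) ?p)"
      using A p(1) t Tf[unfolded set_functor_iff] d by blast+
    show ?thesis using a x2 k q p Dom_Obj Cod_Obj
      by (simp add: uv x' Psi_map_def Psi_def Psi_obj_def bi_seq_simps)
  qed
qed

lemma iSeq_functor: "set_functor (bi_seq_cat C) (iSeq C)"
proof -
  have pO: "prev C M n \<in> Obj C" if "\<And>n. M n \<in> Obj C" for M n
    using that Unit_Obj by (cases n) (auto simp: prev_def)
  have inM: "(M,f) \<in> iSeq_obj C (X,Y) \<longleftrightarrow> (\<forall>n. M n \<in> Obj C) \<and> (\<forall>n. f n \<in> hom C (prev C M n \<otimes> X n) (M n \<otimes> Y n))" for M f X Y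
    by (auto simp: iSeq_obj_def seq_cat_def)
  show ?thesis
    unfolding set_functor_iff
  proof (intro conjI ballI impI)
    fix f x assume f: "f \<in> Arr (bi_seq_cat C)" and x: "x \<in> FObj (iSeq C) (Dom (bi_seq_cat C) f)"
    obtain u v where uv: "f = (u,v)" by (cases f)
    have a: "u n \<in> Arr C" "v n \<in> Arr C" for n using f by (auto simp: uv bi_seq_simps)
    obtain M g where x': "x = (M,g)" by (cases x)
    have x2: "M n \<in> Obj C" "g n \<in> hom C (prev C M n \<otimes> Cod C (u n)) (M n \<otimes> Dom C (v n))" for n
      using x by (auto simp: uv x' iSeq_def inM bi_seq_simps)
    have "(Ide C (M n) \<boxtimes> v n) \<cdot> g n \<cdot> (Ide C (prev C M n) \<boxtimes> u n) \<in> hom C (prev C M n \<otimes> Dom C (u n)) (M n \<otimes> Cod C (v n))" for n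
      by (rule Comp_hom[OF Comp_hom[OF wh] wh]) (use a x2 pO in auto)
    then show "FArr (iSeq C) f x \<in> FObj (iSeq C) (Cod (bi_seq_cat C) f)"
      using x x2 by (simp add: uv x' iSeq_def inM bi_seq_simps)
  next
    fix f assume "f \<in> Arr (bi_seq_cat C)" 
    show "FArr (iSeq C) f \<in> extensional (FObj (iSeq C) (Dom (bi_seq_cat C) f))"
      by (cases f) (simp add: iSeq_def)
  next
    fix a assume a: "a \<in> Obj (bi_seq_cat C)"
    obtain X Y where XY: "a = (X,Y)" by (cases a)
    have o: "X n \<in> Obj C" "Y n \<in> Obj C" for n using a by (auto simp: XY bi_seq_simps)
    have d: "(\<lambda>n. Dom C (Ide C (X n))) = X" "(\<lambda>n. Cod C (Ide C (X n))) = X"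
       "(\<lambda>n. Dom C (Ide C (Y n))) = Y" "(\<lambda>n. Cod C (Ide C (Y n))) = Y"
       using Id_hom o by (auto simp: hom_iff)
    have "(\<lambda>n. (Ide C (M n) \<boxtimes> Ide C (Y n)) \<cdot> f n \<cdot> (Ide C (prev C M n) \<boxtimes> Ide C (X n))) = f"
      if "(M,f) \<in> iSeq_obj C (X,Y)" for M f
    proof
      fix n
      have f: "M n \<in> Obj C" "f n \<in> hom C (prev C M n \<otimes> X n) (M n \<otimes> Y n)" "prev C M n \<in> Obj C"
        using that pO by (auto simp: inM)
      show "(Ide C (M n) \<boxtimes> Ide C (Y n)) \<cdot> f n \<cdot> (Ide C (prev C M n) \<boxtimes> Ide C (X n)) = f n"
        using f o TensA_Id Id_left Id_right by metis
    qed
    then show "FArr (iSeq C) (Ide (bi_seq_cat C) a) = (\<lambda>x\<in>FObj (iSeq C) a. x)"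
      by (auto simp: XY iSeq_def bi_seq_simps d intro!: restrict_ext)
  next
    fix f g assume f: "f \<in> Arr (bi_seq_cat C)" and g: "g \<in> Arr (bi_seq_cat C)" and gf: "Dom (bi_seq_cat C) g = Cod (bi_seq_cat C) f"
    obtain u v where uv: "f = (u,v)" by (cases f)
    obtain u' v' where uv': "g = (u',v')" by (cases g)
    have a: "u n \<in> Arr C" "v n \<in> Arr C" "u' n \<in> Arr C" "v' n \<in> Arr C" 
        "Dom C (u n) = Cod C (u' n)" "Dom C (v' n) = Cod C (v n)" for n 
      using f g gf by (auto simp: uv uv' bi_seq_simps fun_eq_iff)
    have c: "Cod C (u n \<cdot> u' n) = Cod C (u n)" "Dom C (v' n \<cdot> v n) = Dom C (v n)" for n
      using a Arr_hom Comp_hom DC by metis+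
    have "FArr (iSeq C) (g \<cdot>\<^bsub>bi_seq_cat C\<^esub> f) x = FArr (iSeq C) g (FArr (iSeq C) f x)"
      if x: "x \<in> FObj (iSeq C) (Dom (bi_seq_cat C) f)" for x
    proof -
      obtain M h where x': "x = (M,h)" by (cases x)
      have x2: "M n \<in> Obj C" "h n \<in> hom C (prev C M n \<otimes> Cod C (u n)) (M n \<otimes> Dom C (v n))" "prev C M n \<in> Obj C" for n
        using x pO by (auto simp: uv x' iSeq_def inM bi_seq_simps)
      have k: "(Ide C (M n) \<boxtimes> v n) \<cdot> h n \<cdot> (Ide C (prev C M n) \<boxtimes> u n) \<in> hom C (prev C M n \<otimes> Dom C (u n)) (M n \<otimes> Cod C (v n))" for n
        by (rule Comp_hom[OF Comp_hom[OF wh] wh]) (use a x2 pO in auto)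
      have "Ide C (M n) \<boxtimes> (v' n \<cdot> v n) = (Ide C (M n) \<boxtimes> v' n) \<cdot> (Ide C (M n) \<boxtimes> v n)"
        "Ide C (prev C M n) \<boxtimes> (u n \<cdot> u' n) = (Ide C (prev C M n) \<boxtimes> u n) \<cdot> (Ide C (prev C M n) \<boxtimes> u' n)" for n
        using a x2 wh_Comp Arr_hom by metis+
      moreover have "((Ide C (M n) \<boxtimes> v' n) \<cdot> (Ide C (M n) \<boxtimes> v n)) \<cdot> h n \<cdot> ((Ide C (prev C M n) \<boxtimes> u n) \<cdot> (Ide C (prev C M n) \<boxtimes> u' n)) = (Ide C (M n) \<boxtimes> v' n) \<cdot> ((Ide C (M n) \<boxtimes> v n) \<cdot> h n \<cdot> (Ide C (prev C M n) \<boxtimes> u n)) \<cdot> (Ide C (prev C M n) \<boxtimes> u' n)" for n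
        using five[OF wh[OF x2(3)[of n] a(3)[of n]] wh[OF x2(3)[of n] a(1)[of n], unfolded a(5)] x2(2)[of n] wh[OF x2(1)[of n] a(2)[of n]] wh[OF x2(1)[of n] a(4)[of n], unfolded a(6)]] .
      ultimately show ?thesis using x x2 a k c
        by (simp add: uv uv' x' iSeq_def inM bi_seq_simps)
    qed
    moreover have "Dom (bi_seq_cat C) (Comp (bi_seq_cat C) g f) = Dom (bi_seq_cat C) f"
      using c by (simp add: uv uv' bi_seq_simps)
    moreover have "FArr (iSeq C) f \<in> extensional (FObj (iSeq C) (Dom (bi_seq_cat C) f))" for f
      by (cases f) (simp add: iSeq_def)
    ultimately show "FArr (iSeq C) (Comp (bi_seq_cat C) g f) = (\<lambda>x\<in>FObj (iSeq C) (Dom (bi_seq_cat C) f). FArr (iSeq C) g (FArr (iSeq C) f x))"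
      by (intro ext_eq) metis+
  qed
qed

lemma Psi_map_id: "Psi_map C T (nat_id (bi_seq_cat C) T) = nat_id (bi_seq_cat C) (Psi C T)"
proof -
  show ?thesis
    unfolding Psi_map_def nat_id_def
    using act_Obj by (auto simp: Psi_def Psi_obj_def intro!: restrict_ext)
qed

lemma Psi_map_comp:
  assumes "nat_trans (bi_seq_cat C) T S \<alpha>"
  shows "Psi_map C T (nat_comp (bi_seq_cat C) T \<beta> \<alpha>) =
     nat_comp (bi_seq_cat C) (Psi C T) (Psi_map C S \<beta>) (Psi_map C T \<alpha>)"
proof -
  show ?thesis
    using act_Obj assms unfolding Psi_map_def nat_comp_def compose_def nat_trans_iff
    by (auto simp: Psi_def Psi_obj_def intro!: restrict_ext)
qed

end
end

theory Submission imports Defs begin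

text \<open>An intensional sequence is determined by its stream of successive heads, obtained by iterating
  \<^const>\<open>iSeq_split\<close>; since unitors are invertible, this yields a coinduction principle: bisimilar
  sequences are equal. A coalgebra is unfolded into the sequence of its successive heads, where the
  domain \<open>M\<^sub>n\<^sub>-\<^sub>1 \<otimes> X\<^sub>n\<close> of the \<open>n\<close>-th head comes from the action \<open>M \<cdot> X\<^sup>+\<close>. Naturality and uniqueness of
  the unfolding are both instances of coinduction.\<close>

section \<open>Natural transformations\<close>

lemma nat_trans_comp:
  assumes "nat_trans D F G \<alpha>" and "nat_trans D G H \<beta>" and "category D" and "set_functor D F"
  shows "nat_trans D F H (nat_comp D F \<beta> \<alpha>)"
proof -
  have "\<forall>f\<in>Arr D. Dom D f \<in> Obj D \<and> Cod D f \<in> Obj D"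
    using assms(3) by (simp add: category_def)
  then show ?thesis
    using assms unfolding nat_trans_iff set_functor_iff nat_comp_def
    by (auto simp: compose_def)
qed

lemma nat_trans_id:
  assumes "category D" and "set_functor D F"
  shows "nat_trans D F F (nat_id D F)"
proof -
  have "\<forall>f\<in>Arr D. Dom D f \<in> Obj D \<and> Cod D f \<in> Obj D"
    using assms(1) by (simp add: category_def)
  then show ?thesis
    using assms unfolding nat_trans_iff set_functor_iff nat_id_def by auto
qed

text \<open>Componentwise inverses of a natural family are again natural: the square for the inverse
  is checked after applying \<open>\<alpha>\<close> at the codomain, where injectivity reflects the
  equation.\<close>

lemma nat_iso_if_bij_betw:
  assumes \<alpha>: "nat_trans D F G \<alpha>" and D: "category D"
    and F: "set_functor D F" and G: "set_functor D G"
    and bij: "\<And>a. a \<in> Obj D \<Longrightarrow> bij_betw (\<alpha> a) (FObj F a) (FObj G a)"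
  shows "nat_iso D F G \<alpha>"
proof -
  \<comment> \<open>Both restrictions make \<open>\<beta>\<close> extensional, as
    \<open>nat_trans\<close> demands of a family and of each of its components.\<close>
  define \<beta> where "\<beta> = (\<lambda>a\<in>Obj D. \<lambda>y\<in>FObj G a. inv_into (FObj F a) (\<alpha> a) y)"
  have DC: "Dom D f \<in> Obj D" "Cod D f \<in> Obj D" if "f \<in> Arr D" for f
    using D that by (auto simp: category_def)
  have inj: "\<beta> a (\<alpha> a x) = x" if "a \<in> Obj D" "x \<in> FObj F a" for a x
    using that bij[OF that(1)] by (auto simp: \<beta>_def bij_betw_def)
  have surj: "\<beta> a y \<in> FObj F a" "\<alpha> a (\<beta> a y) = y" if "a \<in> Obj D" "y \<in> FObj G a" for a y
    using that bij[OF that(1)] by (auto simp: \<beta>_def bij_betw_def f_inv_into_f inv_into_into)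
  have "\<beta> (Cod D f) (FArr G f y) = FArr F f (\<beta> (Dom D f) y)"
    if f: "f \<in> Arr D" and y: "y \<in> FObj G (Dom D f)" for f y
  proof -
    let ?x = "\<beta> (Dom D f) y"
    have x: "?x \<in> FObj F (Dom D f)" "\<alpha> (Dom D f) ?x = y"
      using surj DC(1)[OF f] y by auto
    then have "\<alpha> (Cod D f) (FArr F f ?x) = FArr G f y"
      using \<alpha> f unfolding nat_trans_iff by metis
    moreover have "FArr F f ?x \<in> FObj F (Cod D f)"
      using F f x unfolding set_functor_iff by blast
    ultimately show ?thesis
      using inj DC(2)[OF f] by metis
  qed
  then have "nat_trans D G F \<beta>"
    using surj(1) unfolding nat_trans_iff by (auto simp: \<beta>_def)
  moreover have "nat_comp D F \<beta> \<alpha> = nat_id D F" "nat_comp D G \<alpha> \<beta> = nat_id D G"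
    using inj surj(2) by (auto simp: nat_comp_def nat_id_def compose_def intro!: restrict_ext)
  ultimately show ?thesis
    using \<alpha> by (auto simp: nat_iso_def)
qed

section \<open>Inverses of isomorphisms in a category\<close>

context category begin

text \<open>The definite description in \<open>inv_arr\<close> denotes something only because
  inverses are unique:
  \<open>g = (g' \<cdot> f) \<cdot> g = g' \<cdot> (f \<cdot> g) = g'\<close>.\<close>

lemma inverse_arr_inv_arr:
  assumes "iso_arr C f"
  shows "inverse_arr C f (inv_arr C f)"
proof -
  have "g = g'" if g: "inverse_arr C f g" and g': "inverse_arr C f g'" for g g'
  proof -
    note G = g[unfolded inverse_arr_def] g'[unfolded inverse_arr_def]
    have f: "f \<in> hom C (Dom C f) (Cod C f)" using G by (simp add: hom_def)
    have "g = (g' \<cdot> f) \<cdot> g" using G Id_left by metis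
    also have "\<dots> = g' \<cdot> (f \<cdot> g)" using G f Comp_assoc by metis
    also have "\<dots> = g'" using G Id_right by metis
    finally show ?thesis .
  qed
  then show ?thesis
    using assms unfolding iso_arr_def inv_arr_def by (metis theI)
qed

text \<open>The composites are bracketed in the way in which \<open>iSeq_split\<close> and
  \<open>unfold_iSeq\<close> attach unitors on the right of a head, so that adding and removing one
  cancels directly.\<close>

lemma
  assumes "iso_arr C l" and l: "l \<in> hom C a b"
  shows inv_arr_hom: "inv_arr C l \<in> hom C b a"
    and Comp_inv_arr_cancel: "f \<in> hom C b c \<Longrightarrow> (f \<cdot> l) \<cdot> inv_arr C l = f"
    and inv_arr_Comp_cancel: "g \<in> hom C a c \<Longrightarrow> (g \<cdot> inv_arr C l) \<cdot> l = g"
proof -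
  note I = inverse_arr_inv_arr[OF assms(1), unfolded inverse_arr_def]
  have ab: "Dom C l = a" "Cod C l = b" using l by (auto simp: hom_def)
  show i: "inv_arr C l \<in> hom C b a" using I ab by simp
  show "(f \<cdot> l) \<cdot> inv_arr C l = f" if "f \<in> hom C b c"
    using Comp_assoc[OF i l that] Id_right[OF that] I ab by simp
  show "(g \<cdot> inv_arr C l) \<cdot> l = g" if "g \<in> hom C a c"
    using Comp_assoc[OF l i that] Id_right[OF that] I ab by simp
qed

end

section \<open>Coalgebras and their morphisms\<close>

context symmetric_monoidal_category begin

lemma category_bi_seq_cat: "category (bi_seq_cat C)"
  by (intro category_prod_cat category_op_cat category_seq_cat category_axioms)

lemma FObj_Psi_iff:
  "(M, f, t) \<in> FObj (Psi C T) (X, Y) \<longleftrightarrow>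
     M \<in> Obj C \<and> f \<in> hom C (X 0) (M \<otimes> Y 0) \<and> t \<in> FObj T (actO C M (tail X), tail Y)"
  by (auto simp: Psi_def Psi_obj_def)

text \<open>Turns the equation between restricted families into one about elements. As
  \<open>\<tau>\<close> takes values in \<open>Psi_obj\<close>, the set on which
  \<open>Psi_map\<close> is given by its formula, the restrictions disappear.\<close>

lemma Psi_coalgebra_hom_iff:
  assumes "Psi_coalgebra C T \<tau>"
  shows "Psi_coalgebra_hom C T \<tau> S \<sigma> h \<longleftrightarrow> nat_trans (bi_seq_cat C) T S h \<and>
     (\<forall>X Y. (X, Y) \<in> Obj (bi_seq_cat C) \<longrightarrow> (\<forall>x\<in>FObj T (X, Y). \<forall>M f t.
        \<tau> (X, Y) x = (M, f, t) \<longrightarrow>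
        \<sigma> (X, Y) (h (X, Y) x) = (M, f, h (actO C M (tail X), tail Y) t)))"
proof -
  have \<tau>: "\<tau> a x \<in> Psi_obj C T a" if "a \<in> Obj (bi_seq_cat C)" "x \<in> FObj T a" for a x
    using assms that by (auto simp: Psi_coalgebra_def nat_trans_iff Psi_def)
  have "nat_comp (bi_seq_cat C) T \<sigma> h = nat_comp (bi_seq_cat C) T (Psi_map C T h) \<tau> \<longleftrightarrow>
    (\<forall>a\<in>Obj (bi_seq_cat C). \<forall>x\<in>FObj T a. \<sigma> a (h a x) = Psi_map C T h a (\<tau> a x))"
    unfolding nat_comp_def compose_def by (auto simp: restrict_def fun_eq_iff)
  also have "\<dots> \<longleftrightarrow> (\<forall>a\<in>Obj (bi_seq_cat C). \<forall>x\<in>FObj T a. \<sigma> a (h a x) =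
      (case a of (X, Y) \<Rightarrow> case \<tau> a x of (M, f, t) \<Rightarrow> (M, f, h (actO C M (tail X), tail Y) t)))"
    using \<tau> by (intro ball_cong refl) (auto simp: Psi_map_def split: prod.splits; metis)
  finally show ?thesis
    unfolding Psi_coalgebra_hom_def by (fastforce split: prod.splits)
qed

lemma Psi_coalgebra_hom_id:
  assumes "Psi_coalgebra C T \<tau>"
  shows "Psi_coalgebra_hom C T \<tau> T \<tau> (nat_id (bi_seq_cat C) T)"
proof -
  have \<tau>: "\<tau> a x \<in> FObj (Psi C T) a" if "a \<in> Obj (bi_seq_cat C)" "x \<in> FObj T a" for a x
    using assms that by (auto simp: Psi_coalgebra_def nat_trans_iff)
  have "nat_trans (bi_seq_cat C) T T (nat_id (bi_seq_cat C) T)"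
    using assms nat_trans_id category_bi_seq_cat by (auto simp: Psi_coalgebra_def)
  moreover have "nat_id (bi_seq_cat C) T (actO C M (tail X), tail Y) t = t"
    if "(X, Y) \<in> Obj (bi_seq_cat C)" "x \<in> FObj T (X, Y)" "\<tau> (X, Y) x = (M, f, t)" for X Y x M f t
    using \<tau>[OF that(1,2)] that act_Obj by (auto simp: FObj_Psi_iff nat_id_def)
  ultimately show ?thesis
    unfolding Psi_coalgebra_hom_iff[OF assms] by (simp add: nat_id_def)
qed

text \<open>Together with identities, composites serve to show that two final coalgebras are
  isomorphic.\<close>

lemma Psi_coalgebra_hom_comp:
  assumes T: "Psi_coalgebra C T \<tau>" and S: "Psi_coalgebra C S \<sigma>"
    and h: "Psi_coalgebra_hom C T \<tau> S \<sigma> h" and k: "Psi_coalgebra_hom C S \<sigma> R \<rho> k"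
  shows "Psi_coalgebra_hom C T \<tau> R \<rho> (nat_comp (bi_seq_cat C) T k h)"
proof -
  note H = h[unfolded Psi_coalgebra_hom_iff[OF T]] and K = k[unfolded Psi_coalgebra_hom_iff[OF S]]
  have \<tau>: "\<tau> a x \<in> FObj (Psi C T) a" if "a \<in> Obj (bi_seq_cat C)" "x \<in> FObj T a" for a x
    using T that by (auto simp: Psi_coalgebra_def nat_trans_iff)
  have hS: "h a x \<in> FObj S a" if "a \<in> Obj (bi_seq_cat C)" "x \<in> FObj T a" for a x
    using H that by (auto simp: nat_trans_iff)
  have "nat_trans (bi_seq_cat C) T R (nat_comp (bi_seq_cat C) T k h)"
    using H K T nat_trans_comp category_bi_seq_cat by (auto simp: Psi_coalgebra_def)
  moreover have "\<rho> (X, Y) (nat_comp (bi_seq_cat C) T k h (X, Y) x) =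
      (M, f, nat_comp (bi_seq_cat C) T k h (actO C M (tail X), tail Y) t)"
    if XY: "(X, Y) \<in> Obj (bi_seq_cat C)" and x: "x \<in> FObj T (X, Y)"
      and eq: "\<tau> (X, Y) x = (M, f, t)" for X Y x M f t
  proof -
    have "M \<in> Obj C" and t: "t \<in> FObj T (actO C M (tail X), tail Y)"
      using \<tau>[OF XY x] eq by (auto simp: FObj_Psi_iff)
    \<comment> \<open>\<open>nat_comp\<close> is restricted to objects, so evaluating it at the
      successor state requires the shifted pair to be an object.\<close>
    then have a': "(actO C M (tail X), tail Y) \<in> Obj (bi_seq_cat C)"
      using act_Obj XY by blast
    have "\<sigma> (X, Y) (h (X, Y) x) = (M, f, h (actO C M (tail X), tail Y) t)"
      using H XY x eq by blast
    then have "\<rho> (X, Y) (k (X, Y) (h (X, Y) x)) =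
        (M, f, k (actO C M (tail X), tail Y) (h (actO C M (tail X), tail Y) t))"
      using K XY hS[OF XY x] by blast
    then show ?thesis
      using XY x a' t by (simp add: nat_comp_def compose_def)
  qed
  ultimately show ?thesis
    unfolding Psi_coalgebra_hom_iff[OF T] by blast
qed

section \<open>Splitting off the first component\<close>

lemma tail_apply [simp]: "tail X n = X (Suc n)"
  by (simp add: tail_def)

lemma prev_simps [simp]: "prev C M 0 = Unit C" "prev C M (Suc n) = M n"
  by (simp_all add: prev_def)

lemma FObj_iSeq_iff:
  "(M, f) \<in> FObj (iSeq C) (X, Y) \<longleftrightarrow>
     (\<forall>n. M n \<in> Obj C) \<and> (\<forall>n. f n \<in> hom C (prev C M n \<otimes> X n) (M n \<otimes> Y n))"
  by (auto simp: iSeq_def iSeq_obj_def seq_cat_def)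

lemma Obj_bi_seq_iff:
  "(X, Y) \<in> Obj (bi_seq_cat C) \<longleftrightarrow> (\<forall>n. X n \<in> Obj C) \<and> (\<forall>n. Y n \<in> Obj C)"
  by (auto simp: bi_seq_simps)

lemma iSeq_split_eq:
  assumes "(X, Y) \<in> Obj (bi_seq_cat C)" and "(M, f) \<in> FObj (iSeq C) (X, Y)"
  shows "iSeq_split C (X, Y) (M, f) =
     (M 0, f 0 \<cdot> inv_arr C (Lunit C (X 0)),
      tail M, (tail f)(0 := f 1 \<cdot> Lunit C (M 0 \<otimes> X 1)))"
  using assms by (simp add: iSeq_split_def iSeq_def)

section \<open>The left unitor: cancellation and naturality of its inverse\<close>

lemma
  assumes "a \<in> Obj C"
  shows Lunit_inv_hom: "inv_arr C (Lunit C a) \<in> hom C a (Unit C \<otimes> a)"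
    and Lunit_cancel: "f \<in> hom C a c \<Longrightarrow> (f \<cdot> Lunit C a) \<cdot> inv_arr C (Lunit C a) = f"
    and Lunit_inv_cancel:
      "g \<in> hom C (Unit C \<otimes> a) c \<Longrightarrow> (g \<cdot> inv_arr C (Lunit C a)) \<cdot> Lunit C a = g"
  using assms inv_arr_hom Comp_inv_arr_cancel inv_arr_Comp_cancel Lunit_iso Lunit_hom by blast+

text \<open>Insert \<open>?l \<cdot> Lunit C b\<close>, an identity, in front of the whiskered
  arrow, slide \<open>u\<close> past the unitor by naturality, and cancel \<open>Lunit C a\<close>
  against its inverse on the right.\<close>

lemma Lunit_inv_nat:
  assumes "u \<in> hom C a b"
  shows "(Ide C (Unit C) \<boxtimes> u) \<cdot> inv_arr C (Lunit C a) = inv_arr C (Lunit C b) \<cdot> u"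
proof -
  have a: "a \<in> Obj C" and b: "b \<in> Obj C" using hom_Obj[OF assms] by auto
  let ?l = "inv_arr C (Lunit C b)"
  have w: "Ide C (Unit C) \<boxtimes> u \<in> hom C (Unit C \<otimes> a) (Unit C \<otimes> b)"
    using TensA_hom[OF Id_hom[OF Unit_Obj] assms] .
  have "?l \<cdot> Lunit C b = Ide C (Unit C \<otimes> b)"
    using inverse_arr_inv_arr[OF Lunit_iso[OF b]] Lunit_hom[OF b]
    by (simp add: inverse_arr_def hom_def)
  then have "Ide C (Unit C) \<boxtimes> u = (?l \<cdot> Lunit C b) \<cdot> (Ide C (Unit C) \<boxtimes> u)"
    using Id_left[OF w] by simp
  also have "\<dots> = ?l \<cdot> (u \<cdot> Lunit C a)"
    using Comp_assoc[OF w Lunit_hom[OF b] Lunit_inv_hom[OF b]] Lunit_nat[OF assms] by simp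
  also have "\<dots> = (?l \<cdot> u) \<cdot> Lunit C a"
    using Comp_assoc[OF Lunit_hom[OF a] assms Lunit_inv_hom[OF b]] by simp
  finally show ?thesis
    using Lunit_cancel[OF a Comp_hom[OF assms Lunit_inv_hom[OF b]]] by simp
qed

lemma iSeq_split_in:
  assumes XY: "(X, Y) \<in> Obj (bi_seq_cat C)" and x: "x \<in> FObj (iSeq C) (X, Y)"
  shows "iSeq_split C (X, Y) x \<in> FObj (Psi C (iSeq C)) (X, Y)"
proof -
  obtain M f where Mf: "x = (M, f)" by (cases x)
  have o: "X n \<in> Obj C" "M n \<in> Obj C" for n
    using XY x by (auto simp: Mf Obj_bi_seq_iff FObj_iSeq_iff)
  have f: "f n \<in> hom C (prev C M n \<otimes> X n) (M n \<otimes> Y n)" for n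
    using x by (auto simp: Mf FObj_iSeq_iff)
  have "f 0 \<cdot> inv_arr C (Lunit C (X 0)) \<in> hom C (X 0) (M 0 \<otimes> Y 0)"
    using Comp_hom[OF Lunit_inv_hom f[of 0, simplified]] o by simp
  moreover have "f 1 \<cdot> Lunit C (M 0 \<otimes> X 1) \<in> hom C (Unit C \<otimes> M 0 \<otimes> X 1) (M 1 \<otimes> Y 1)"
    using Comp_hom[OF Lunit_hom f[of 1, simplified]] o by (simp add: TensO_Obj)
  moreover have "f (Suc n) \<in> hom C (M n \<otimes> X (Suc n)) (M (Suc n) \<otimes> Y (Suc n))" for n
    using f[of "Suc n"] by simp
  \<comment> \<open>This fails at index 0, where the left side is the unit and the right side is
    \<open>M 0\<close>; that mismatch is what the unitor on the head of the tail repairs.\<close>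
  moreover have "prev C (tail M) n = prev C M (Suc n)" if "n > 0" for n
    using that by (cases n) auto
  ultimately show ?thesis
    using XY x o f by (auto simp: Mf iSeq_split_eq FObj_Psi_iff FObj_iSeq_iff act_seq)
qed

lemma iSeq_split_inj:
  assumes XY: "(X, Y) \<in> Obj (bi_seq_cat C)"
  shows "inj_on (iSeq_split C (X, Y)) (FObj (iSeq C) (X, Y))"
proof (intro inj_onI)
  fix x x' assume x: "x \<in> FObj (iSeq C) (X, Y)" and x': "x' \<in> FObj (iSeq C) (X, Y)"
    and eq: "iSeq_split C (X, Y) x = iSeq_split C (X, Y) x'"
  obtain M f where Mf: "x = (M, f)" by (cases x)
  obtain M' f' where Mf': "x' = (M', f')" by (cases x')
  have X: "X n \<in> Obj C" for n using XY by (auto simp: Obj_bi_seq_iff)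
  note E = eq[unfolded Mf Mf' iSeq_split_eq[OF XY x[unfolded Mf]] iSeq_split_eq[OF XY x'[unfolded Mf']]]
  have M: "M = M'"
  proof
    show "M n = M' n" for n
      using E by (cases n) (auto simp: fun_eq_iff)
  qed
  have hom: "M n \<in> Obj C" "f n \<in> hom C (prev C M n \<otimes> X n) (M n \<otimes> Y n)"
    "f' n \<in> hom C (prev C M n \<otimes> X n) (M n \<otimes> Y n)" for n
    using x x' M by (auto simp: Mf Mf' FObj_iSeq_iff)
  have "f n = f' n" for n
  proof -
    \<comment> \<open>Indices 0 and 1 are those at which splitting composes with an inverse unitor
      and a unitor, which have to be cancelled. From 2 on the components are only shifted.\<close>
    consider "n = 0" | "n = 1" | m where "n = Suc (Suc m)"
      by (metis One_nat_def not0_implies_Suc)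
    then show ?thesis
    proof cases
      case 1
      have "f 0 \<cdot> inv_arr C (Lunit C (X 0)) = f' 0 \<cdot> inv_arr C (Lunit C (X 0))"
        using E by simp
      then show ?thesis
        using 1 Lunit_inv_cancel[OF X hom(2)[of 0, simplified]]
          Lunit_inv_cancel[OF X hom(3)[of 0, simplified]] by metis
    next
      case 2
      have MX: "M 0 \<otimes> X 1 \<in> Obj C" using hom(1) X TensO_Obj by blast
      have "f 1 \<in> hom C (M 0 \<otimes> X 1) (M 1 \<otimes> Y 1)" "f' 1 \<in> hom C (M 0 \<otimes> X 1) (M 1 \<otimes> Y 1)"
        using hom(2,3)[of 1] by simp_all
      moreover have "f 1 \<cdot> Lunit C (M 0 \<otimes> X 1) = f' 1 \<cdot> Lunit C (M 0 \<otimes> X 1)"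
        using E M by (auto dest: fun_cong[of _ _ 0])
      ultimately show ?thesis
        using 2 Lunit_cancel[OF MX] by metis
    next
      case 3
      have "((tail f)(0 := f 1 \<cdot> Lunit C (M 0 \<otimes> X 1))) (Suc m) =
          ((tail f')(0 := f' 1 \<cdot> Lunit C (M 0 \<otimes> X 1))) (Suc m)"
        using E M by simp
      then show ?thesis using 3 by simp
    qed
  qed
  then show "x = x'" using M by (auto simp: Mf Mf')
qed

lemma iSeq_split_surj:
  assumes XY: "(X, Y) \<in> Obj (bi_seq_cat C)" and y: "y \<in> FObj (Psi C (iSeq C)) (X, Y)"
  shows "\<exists>x\<in>FObj (iSeq C) (X, Y). iSeq_split C (X, Y) x = y"
proof -
  obtain M f N g where y': "y = (M, f, N, g)" by (cases y)
  have X: "X n \<in> Obj C" for n using XY by (auto simp: Obj_bi_seq_iff)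
  have M: "M \<in> Obj C" and f: "f \<in> hom C (X 0) (M \<otimes> Y 0)" and N: "N n \<in> Obj C"
    and g: "g n \<in> hom C (prev C N n \<otimes> actO C M (tail X) n) (N n \<otimes> tail Y n)" for n
    using y by (auto simp: y' FObj_Psi_iff FObj_iSeq_iff)
  \<comment> \<open>The preimage prepends the head and undoes both unitors: \<open>f\<close>
    receives \<open>Lunit\<close>, the head of the tail receives the inverse unitor.\<close>
  define M' where "M' = case_nat M N"
  define f' where "f' = case_nat (f \<cdot> Lunit C (X 0))
    (g(0 := g 0 \<cdot> inv_arr C (Lunit C (M \<otimes> X 1))))"
  have MX: "M \<otimes> X 1 \<in> Obj C" using M X TensO_Obj by blast
  have g0: "g 0 \<in> hom C (Unit C \<otimes> M \<otimes> X 1) (N 0 \<otimes> Y 1)"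
    using g[of 0] by (simp add: act_seq)
  have "f' n \<in> hom C (prev C M' n \<otimes> X n) (M' n \<otimes> Y n)" for n
  proof -
    consider "n = 0" | "n = 1" | m where "n = Suc (Suc m)"
      by (metis One_nat_def not0_implies_Suc)
    then show ?thesis
    proof cases
      case 1
      then show ?thesis
        using Comp_hom[OF Lunit_hom[OF X] f] by (simp add: f'_def M'_def)
    next
      case 2
      then show ?thesis
        using Comp_hom[OF Lunit_inv_hom[OF MX] g0] by (simp add: f'_def M'_def)
    next
      case (3 m)
      then show ?thesis
        using g[of "Suc m"] by (simp add: f'_def M'_def act_seq)
    qed
  qed
  then have x: "(M', f') \<in> FObj (iSeq C) (X, Y)"
    using M N by (auto simp: FObj_iSeq_iff M'_def split: nat.split)
  have "tail M' = N" "(tail f')(0 := g 0) = g"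
    by (auto simp: M'_def f'_def)
  moreover have "f' 0 \<cdot> inv_arr C (Lunit C (X 0)) = f"
    using Lunit_cancel[OF X f] by (simp add: f'_def)
  moreover have "f' 1 \<cdot> Lunit C (M \<otimes> X 1) = g 0"
    using Lunit_inv_cancel[OF MX g0] by (simp add: f'_def)
  ultimately have "iSeq_split C (X, Y) (M', f') = y"
    unfolding iSeq_split_eq[OF XY x] y' by (simp add: M'_def)
  then show ?thesis using x by blast
qed

text \<open>Only two components need an argument: index 0 uses naturality of the inverse unitor,
  index 1 naturality of the unitor at \<open>Ide C (M 0) \<boxtimes> u 1\<close>. The others agree
  by definition.\<close>

lemma iSeq_split_nat:
  assumes uv: "(u, v) \<in> Arr (bi_seq_cat C)" and x: "x \<in> FObj (iSeq C) (Dom (bi_seq_cat C) (u, v))"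
  shows "iSeq_split C (Cod (bi_seq_cat C) (u, v)) (FArr (iSeq C) (u, v) x) =
    FArr (Psi C (iSeq C)) (u, v) (iSeq_split C (Dom (bi_seq_cat C) (u, v)) x)"
proof -
  define X where "X = (\<lambda>n. Cod C (u n))"
  define X' where "X' = (\<lambda>n. Dom C (u n))"
  define Y where "Y = (\<lambda>n. Dom C (v n))"
  define Y' where "Y' = (\<lambda>n. Cod C (v n))"
  obtain M f where Mf: "x = (M, f)" by (cases x)
  have u: "u n \<in> hom C (X' n) (X n)" and v: "v n \<in> hom C (Y n) (Y' n)" for n
    using uv by (auto simp: bi_seq_simps hom_iff X_def X'_def Y_def Y'_def)
  have dom: "Dom (bi_seq_cat C) (u, v) = (X, Y)" and cod: "Cod (bi_seq_cat C) (u, v) = (X', Y')"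
    by (auto simp: bi_seq_simps X_def X'_def Y_def Y'_def)
  have o: "X n \<in> Obj C" "X' n \<in> Obj C" "Y n \<in> Obj C" "Y' n \<in> Obj C" for n
    using hom_Obj[OF u] hom_Obj[OF v] by auto
  have XY: "(X, Y) \<in> Obj (bi_seq_cat C)" and XY': "(X', Y') \<in> Obj (bi_seq_cat C)"
    using o by (auto simp: Obj_bi_seq_iff)
  have x1: "(M, f) \<in> FObj (iSeq C) (X, Y)" using x by (simp add: Mf dom)
  have M: "M n \<in> Obj C" and f: "f n \<in> hom C (prev C M n \<otimes> X n) (M n \<otimes> Y n)" for n
    using x1 by (auto simp: FObj_iSeq_iff)
  define F where
    "F = (\<lambda>n. (Ide C (M n) \<boxtimes> v n) \<cdot> f n \<cdot> (Ide C (prev C M n) \<boxtimes> u n))"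
  have fx: "FArr (iSeq C) (u, v) x = (M, F)"
    using x1 by (simp add: Mf iSeq_def dom F_def)
  have x2: "(M, F) \<in> FObj (iSeq C) (X', Y')"
    using iSeq_functor uv x unfolding set_functor_iff fx[symmetric] cod[symmetric] by blast
  have wv: "Ide C (M n) \<boxtimes> v n \<in> hom C (M n \<otimes> Y n) (M n \<otimes> Y' n)" for n
    using TensA_hom[OF Id_hom[OF M] v] .
  have "F 0 \<cdot> inv_arr C (Lunit C (X' 0)) =
      (Ide C (M 0) \<boxtimes> v 0) \<cdot> (f 0 \<cdot> inv_arr C (Lunit C (X 0))) \<cdot> u 0"
  proof -
    let ?i = "inv_arr C (Lunit C (X 0))" and ?i' = "inv_arr C (Lunit C (X' 0))"
    let ?w = "Ide C (Unit C) \<boxtimes> u 0"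
    have w: "?w \<in> hom C (Unit C \<otimes> X' 0) (Unit C \<otimes> X 0)"
      using TensA_hom[OF Id_hom[OF Unit_Obj] u] .
    have f0: "f 0 \<in> hom C (Unit C \<otimes> X 0) (M 0 \<otimes> Y 0)" using f[of 0] by simp
    have i: "?i \<in> hom C (X 0) (Unit C \<otimes> X 0)" "?i' \<in> hom C (X' 0) (Unit C \<otimes> X' 0)"
      using Lunit_inv_hom o by auto
    have "F 0 \<cdot> ?i' = (Ide C (M 0) \<boxtimes> v 0) \<cdot> ((f 0 \<cdot> ?w) \<cdot> ?i')"
      using Comp_assoc[OF i(2) Comp_hom[OF w f0] wv] by (simp add: F_def)
    also have "(f 0 \<cdot> ?w) \<cdot> ?i' = f 0 \<cdot> (?i \<cdot> u 0)"
      using Comp_assoc[OF i(2) w f0] Lunit_inv_nat[OF u] by simp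
    also have "\<dots> = (f 0 \<cdot> ?i) \<cdot> u 0"
      using Comp_assoc[OF u i(1) f0] by simp
    finally show ?thesis .
  qed
  \<comment> \<open>On the right \<open>u 1\<close> is whiskered twice: by \<open>M 0\<close>
    through \<open>actA\<close>, and by the unit, which is the memory preceding the first one of the
    tail.\<close>
  moreover have "F 1 \<cdot> Lunit C (M 0 \<otimes> X' 1) = (Ide C (M 1) \<boxtimes> v 1) \<cdot>
      (f 1 \<cdot> Lunit C (M 0 \<otimes> X 1)) \<cdot> (Ide C (Unit C) \<boxtimes> (Ide C (M 0) \<boxtimes> u 1))"
  proof -
    let ?w = "Ide C (M 0) \<boxtimes> u 1"
    let ?l = "Lunit C (M 0 \<otimes> X 1)" and ?l' = "Lunit C (M 0 \<otimes> X' 1)"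
    have w: "?w \<in> hom C (M 0 \<otimes> X' 1) (M 0 \<otimes> X 1)"
      using TensA_hom[OF Id_hom[OF M] u] .
    have Iw: "Ide C (Unit C) \<boxtimes> ?w \<in> hom C (Unit C \<otimes> M 0 \<otimes> X' 1) (Unit C \<otimes> M 0 \<otimes> X 1)"
      using TensA_hom[OF Id_hom[OF Unit_Obj] w] .
    have f1: "f 1 \<in> hom C (M 0 \<otimes> X 1) (M 1 \<otimes> Y 1)" using f[of 1] by simp
    have l: "?l \<in> hom C (Unit C \<otimes> M 0 \<otimes> X 1) (M 0 \<otimes> X 1)"
      "?l' \<in> hom C (Unit C \<otimes> M 0 \<otimes> X' 1) (M 0 \<otimes> X' 1)"
      using Lunit_hom TensO_Obj M o by auto
    have "F 1 \<cdot> ?l' = (Ide C (M 1) \<boxtimes> v 1) \<cdot> ((f 1 \<cdot> ?w) \<cdot> ?l')"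
      using Comp_assoc[OF l(2) Comp_hom[OF w f1] wv] by (simp add: F_def)
    also have "(f 1 \<cdot> ?w) \<cdot> ?l' = f 1 \<cdot> (?l \<cdot> (Ide C (Unit C) \<boxtimes> ?w))"
      using Comp_assoc[OF l(2) w f1] Lunit_nat[OF w] by simp
    also have "\<dots> = (f 1 \<cdot> ?l) \<cdot> (Ide C (Unit C) \<boxtimes> ?w)"
      using Comp_assoc[OF Iw l(1) f1] by simp
    finally show ?thesis .
  qed
  moreover have "FArr (Psi C (iSeq C)) (u, v) (iSeq_split C (X, Y) (M, f)) =
    (M 0, (Ide C (M 0) \<boxtimes> v 0) \<cdot> (f 0 \<cdot> inv_arr C (Lunit C (X 0))) \<cdot> u 0,
     tail M, (tail F)(0 := (Ide C (M 1) \<boxtimes> v 1) \<cdot>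
      (f 1 \<cdot> Lunit C (M 0 \<otimes> X 1)) \<cdot> (Ide C (Unit C) \<boxtimes> (Ide C (M 0) \<boxtimes> u 1))))"
  proof -
    define g where "g = (tail f)(0 := f 1 \<cdot> Lunit C (M 0 \<otimes> X 1))"
    let ?a = "(actO C (M 0) (tail X), tail Y)"
    have s: "iSeq_split C (X, Y) (M, f) = (M 0, f 0 \<cdot> inv_arr C (Lunit C (X 0)), tail M, g)"
      using iSeq_split_eq[OF XY x1] by (simp add: g_def)
    have sP: "(M 0, f 0 \<cdot> inv_arr C (Lunit C (X 0)), tail M, g) \<in> Psi_obj C (iSeq C) (X, Y)"
      using iSeq_split_in[OF XY x1] by (simp add: s Psi_def)
    then have "(tail M, g) \<in> iSeq_obj C ?a"
      by (auto simp: Psi_obj_def iSeq_def)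
    moreover have "Dom (bi_seq_cat C) (actA C (M 0) (tail u), tail v) = ?a"
      using actA_DC[OF M, of u] u v
      by (auto simp: bi_seq_simps hom_iff X_def Y_def fun_eq_iff)
    ultimately have "FArr (iSeq C) (actA C (M 0) (tail u), tail v) (tail M, g) =
      (tail M, \<lambda>n. (Ide C (tail M n) \<boxtimes> tail v n) \<cdot> g n \<cdot>
         (Ide C (prev C (tail M) n) \<boxtimes> actA C (M 0) (tail u) n))"
      by (simp add: iSeq_def)
    also have "\<dots> = (tail M, (tail F)(0 := (Ide C (M 1) \<boxtimes> v 1) \<cdot>
      (f 1 \<cdot> Lunit C (M 0 \<otimes> X 1)) \<cdot> (Ide C (Unit C) \<boxtimes> (Ide C (M 0) \<boxtimes> u 1))))"
      by (auto simp: fun_eq_iff g_def F_def act_seq prev_def split: nat.split)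
    finally show ?thesis
      using sP by (simp add: s Psi_def dom)
  qed
  ultimately show ?thesis
    using iSeq_split_eq[OF XY' x2] by (simp add: dom cod fx) (simp add: Mf)
qed

lemma iSeq_split_nat_trans: "nat_trans (bi_seq_cat C) (iSeq C) (Psi C (iSeq C)) (iSeq_split C)"
  unfolding nat_trans_iff
proof (intro conjI ballI)
  show "iSeq_split C a \<in> extensional (FObj (iSeq C) a)" if "a \<in> Obj (bi_seq_cat C)" for a
    using that by (cases a) (simp add: iSeq_split_def iSeq_def)
  show "iSeq_split C a x \<in> FObj (Psi C (iSeq C)) a"
    if "a \<in> Obj (bi_seq_cat C)" "x \<in> FObj (iSeq C) a" for a x
    using that iSeq_split_in by (cases a) auto
  show "iSeq_split C (Cod (bi_seq_cat C) p) (FArr (iSeq C) p x) =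
      FArr (Psi C (iSeq C)) p (iSeq_split C (Dom (bi_seq_cat C) p) x)"
    if "p \<in> Arr (bi_seq_cat C)" "x \<in> FObj (iSeq C) (Dom (bi_seq_cat C) p)" for p x
    using that iSeq_split_nat by (cases p) auto
qed (simp add: iSeq_split_def)

lemma Psi_coalgebra_iSeq: "Psi_coalgebra C (iSeq C) (iSeq_split C)"
  using iSeq_functor iSeq_split_nat_trans by (simp add: Psi_coalgebra_def)

lemma Psi_fixpoint_iSeq: "Psi_fixpoint C (iSeq C) (iSeq_split C)"
proof -
  have "bij_betw (iSeq_split C a) (FObj (iSeq C) a) (FObj (Psi C (iSeq C)) a)"
    if "a \<in> Obj (bi_seq_cat C)" for a
  proof -
    obtain X Y where a: "a = (X, Y)" by (cases a)
    show ?thesis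
      using that iSeq_split_in[of X Y] iSeq_split_inj[of X Y] iSeq_split_surj[of X Y]
      unfolding a bij_betw_def by (auto simp: image_iff) metis
  qed
  then show ?thesis
    unfolding Psi_fixpoint_def
    by (intro conjI iSeq_functor nat_iso_if_bij_betw iSeq_split_nat_trans category_bi_seq_cat
        Psi_functor)
qed

section \<open>Finality\<close>

text \<open>Sequences are functions on the naturals, so bisimilar ones are compared index by index.
  The index \<open>n + 1\<close> of a sequence is the index \<open>n\<close> of its tail up to a
  unitor, hence an induction that generalizes over \<open>X\<close> and \<open>Y\<close>, which
  change with the tail.\<close>

lemma iSeq_coinduct:
  assumes R: "R X Y x y"
    and step: "\<And>X Y x y. R X Y x y \<Longrightarrow>
      (X, Y) \<in> Obj (bi_seq_cat C) \<and> x \<in> FObj (iSeq C) (X, Y) \<and> y \<in> FObj (iSeq C) (X, Y) \<and>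
      (\<exists>M f x' y'. iSeq_split C (X, Y) x = (M, f, x') \<and> iSeq_split C (X, Y) y = (M, f, y') \<and>
         R (actO C M (tail X)) (tail Y) x' y')"
  shows "x = y"
proof -
  have "fst x n = fst y n \<and> snd x n = snd y n" for n
    using R
  proof (induction n arbitrary: X Y x y)
    case 0
    obtain M f M' f' where xy: "x = (M, f)" "y = (M', f')" by (metis surj_pair)
    have XY: "(X, Y) \<in> Obj (bi_seq_cat C)"
      and x: "(M, f) \<in> FObj (iSeq C) (X, Y)" and y: "(M', f') \<in> FObj (iSeq C) (X, Y)"
      using step[OF 0] by (auto simp: xy)
    have M: "M 0 = M' 0"
      and e: "f 0 \<cdot> inv_arr C (Lunit C (X 0)) = f' 0 \<cdot> inv_arr C (Lunit C (X 0))"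
      using step[OF 0] by (auto simp: xy iSeq_split_eq)
    have X: "X 0 \<in> Obj C" using XY by (simp add: Obj_bi_seq_iff)
    have "f 0 \<in> hom C (Unit C \<otimes> X 0) (M 0 \<otimes> Y 0)" "f' 0 \<in> hom C (Unit C \<otimes> X 0) (M' 0 \<otimes> Y 0)"
      using x y by (auto simp: FObj_iSeq_iff dest: spec[of _ 0])
    then have "f 0 = f' 0"
      using e Lunit_inv_cancel[OF X] by metis
    then show ?case using M by (simp add: xy)
  next
    case (Suc n)
    obtain M f M' f' where xy: "x = (M, f)" "y = (M', f')" by (metis surj_pair)
    have XY: "(X, Y) \<in> Obj (bi_seq_cat C)"
      and x: "(M, f) \<in> FObj (iSeq C) (X, Y)" and y: "(M', f') \<in> FObj (iSeq C) (X, Y)"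
      using step[OF Suc.prems] by (auto simp: xy)
    define g where "g = (tail f)(0 := f 1 \<cdot> Lunit C (M 0 \<otimes> X 1))"
    define g' where "g' = (tail f')(0 := f' 1 \<cdot> Lunit C (M' 0 \<otimes> X 1))"
    have M: "M 0 = M' 0" and "R (actO C (M 0) (tail X)) (tail Y) (tail M, g) (tail M', g')"
      using step[OF Suc.prems] unfolding xy iSeq_split_eq[OF XY x] iSeq_split_eq[OF XY y] g_def g'_def
      by auto
    from Suc.IH[OF this(2)] have IH: "M (Suc n) = M' (Suc n)" "g n = g' n"
      by auto
    have "f (Suc n) = f' (Suc n)"
    \<comment> \<open>For \<open>n = 0\<close> the hypothesis compares heads of tails, which carry a
      unitor to be cancelled; later components of the tails are unchanged ones of \<open>f\<close>
      and \<open>f'\<close>.\<close>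
    proof (cases n)
      case 0
      have MX: "M 0 \<otimes> X 1 \<in> Obj C"
        using XY x TensO_Obj by (simp add: Obj_bi_seq_iff FObj_iSeq_iff)
      have "f 1 \<in> hom C (M 0 \<otimes> X 1) (M 1 \<otimes> Y 1)" "f' 1 \<in> hom C (M 0 \<otimes> X 1) (M' 1 \<otimes> Y 1)"
        using x y M by (auto simp: FObj_iSeq_iff dest!: spec[of _ 1])
      moreover have "f 1 \<cdot> Lunit C (M 0 \<otimes> X 1) = f' 1 \<cdot> Lunit C (M 0 \<otimes> X 1)"
        using IH(2) M 0 by (simp add: g_def g'_def)
      ultimately show ?thesis
        using 0 Lunit_cancel[OF MX] by (metis One_nat_def)
    next
      case (Suc m)
      then show ?thesis using IH(2) by (simp add: g_def g'_def)
    qed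
    then show ?case using IH(1) by (simp add: xy)
  qed
  then show ?thesis by (auto simp: prod_eq_iff)
qed

end

text \<open>The pair of objects travels with the state, since a step with memory \<open>M\<close>
  lands in the fibre over \<open>(actO C M (tail X), tail Y)\<close>.\<close>

primrec heads :: "('o, 'm, 'z) smcat_scheme
    \<Rightarrow> ((nat \<Rightarrow> 'o) \<times> (nat \<Rightarrow> 'o) \<Rightarrow> 'e \<Rightarrow> 'o \<times> 'm \<times> 'e)
    \<Rightarrow> nat \<Rightarrow> (nat \<Rightarrow> 'o) \<times> (nat \<Rightarrow> 'o) \<Rightarrow> 'e \<Rightarrow> 'o \<times> 'm" where
  "heads C \<tau> 0 = (\<lambda>a x. case \<tau> a x of (M, f, t) \<Rightarrow> (M, f))"
| "heads C \<tau> (Suc n) = (\<lambda>(X, Y) x. case \<tau> (X, Y) x of (M, f, t) \<Rightarrow>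
     heads C \<tau> n (actO C M (tail X), tail Y) t)"

text \<open>Only the first head needs a unitor: the later ones already start at \<open>M\<^sub>n\<^sub>-\<^sub>1 \<otimes> X\<^sub>n\<close>.\<close>

definition unfold_iSeq :: "('o, 'm, 'z) smcat_scheme \<Rightarrow> ('o, 'm, 'e) seq_profunctor
    \<Rightarrow> ((nat \<Rightarrow> 'o) \<times> (nat \<Rightarrow> 'o) \<Rightarrow> 'e \<Rightarrow> 'o \<times> 'm \<times> 'e)
    \<Rightarrow> (nat \<Rightarrow> 'o) \<times> (nat \<Rightarrow> 'o) \<Rightarrow> 'e \<Rightarrow> (nat \<Rightarrow> 'o) \<times> (nat \<Rightarrow> 'm)" where
  "unfold_iSeq C T \<tau> = (\<lambda>(X, Y)\<in>Obj (bi_seq_cat C). \<lambda>x\<in>FObj T (X, Y).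
     (\<lambda>n. fst (heads C \<tau> n (X, Y) x),
      (\<lambda>n. snd (heads C \<tau> n (X, Y) x))
        (0 := snd (heads C \<tau> 0 (X, Y) x) \<cdot>\<^bsub>C\<^esub> Lunit C (X 0))))"

section \<open>The unfolding is the unique coalgebra morphism into \<open>iSeq\<close>\<close>

context symmetric_monoidal_category begin

lemma Psi_coalgebra_step:
  assumes "Psi_coalgebra C T \<tau>" and "(X, Y) \<in> Obj (bi_seq_cat C)" and "x \<in> FObj T (X, Y)"
  obtains M f t where "\<tau> (X, Y) x = (M, f, t)" and "M \<in> Obj C" and "f \<in> hom C (X 0) (M \<otimes> Y 0)"
    and "t \<in> FObj T (actO C M (tail X), tail Y)"
    and "(actO C M (tail X), tail Y) \<in> Obj (bi_seq_cat C)"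
proof -
  obtain M f t where eq: "\<tau> (X, Y) x = (M, f, t)" by (metis surj_pair)
  have "\<tau> (X, Y) x \<in> FObj (Psi C T) (X, Y)"
    using assms by (auto simp: Psi_coalgebra_def nat_trans_iff)
  then show ?thesis
    using that[OF eq] act_Obj[OF assms(2)] by (auto simp: eq FObj_Psi_iff)
qed

text \<open>The memory emitted by one step is tensored onto the next input by the action, so the
  \<open>n\<close>-th head starts at the preceding memory tensored with \<open>X n\<close>.\<close>

lemma heads_hom:
  assumes T: "Psi_coalgebra C T \<tau>" and "(X, Y) \<in> Obj (bi_seq_cat C)" and "x \<in> FObj T (X, Y)"
  shows "fst (heads C \<tau> n (X, Y) x) \<in> Obj C \<and>
    snd (heads C \<tau> n (X, Y) x) \<in> hom C
      (case n of 0 \<Rightarrow> X 0 | Suc k \<Rightarrow> fst (heads C \<tau> k (X, Y) x) \<otimes> X n)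
      (fst (heads C \<tau> n (X, Y) x) \<otimes> Y n)"
  using assms(2,3)
proof (induction n arbitrary: X Y x)
  case 0
  then show ?case by (rule Psi_coalgebra_step[OF T]) simp
next
  case (Suc n)
  obtain M f t where s: "\<tau> (X, Y) x = (M, f, t)" "t \<in> FObj T (actO C M (tail X), tail Y)"
    "(actO C M (tail X), tail Y) \<in> Obj (bi_seq_cat C)"
    by (rule Psi_coalgebra_step[OF T Suc.prems])
  define X' where "X' = actO C M (tail X)"
  define Y' where "Y' = tail Y"
  have X': "X' 0 = M \<otimes> X 1" "X' (Suc k) = X (Suc (Suc k))" "Y' k = Y (Suc k)" for k
    by (simp_all add: X'_def Y'_def act_seq)
  have "fst (heads C \<tau> n (X', Y') t) \<in> Obj C \<and>
    snd (heads C \<tau> n (X', Y') t) \<in> hom C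
      (case n of 0 \<Rightarrow> X' 0 | Suc k \<Rightarrow> fst (heads C \<tau> k (X', Y') t) \<otimes> X' n)
      (fst (heads C \<tau> n (X', Y') t) \<otimes> Y' n)"
    unfolding X'_def Y'_def by (rule Suc.IH[OF s(3,2)])
  then show ?case
    \<comment> \<open>For \<open>n = 0\<close> the memory preceding head 1 is \<open>M\<close>
      itself, hidden in \<open>X' 0\<close>; for larger \<open>n\<close> it is an earlier head of
      the successor \<open>t\<close>.\<close>
    by (cases n) (simp_all add: s(1) X' flip: X'_def Y'_def)
qed

lemma unfold_iSeq_in:
  assumes T: "Psi_coalgebra C T \<tau>" and XY: "(X, Y) \<in> Obj (bi_seq_cat C)" and x: "x \<in> FObj T (X, Y)"
  shows "unfold_iSeq C T \<tau> (X, Y) x \<in> FObj (iSeq C) (X, Y)"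
proof -
  note h = heads_hom[OF T XY x]
  have "X 0 \<in> Obj C" using XY by (simp add: Obj_bi_seq_iff)
  then have "snd (heads C \<tau> 0 (X, Y) x) \<cdot> Lunit C (X 0)
      \<in> hom C (Unit C \<otimes> X 0) (fst (heads C \<tau> 0 (X, Y) x) \<otimes> Y 0)"
    using h[of 0] by (auto intro: Comp_hom[OF Lunit_hom])
  moreover have "snd (heads C \<tau> n (X, Y) x) \<in> hom C
      (prev C (\<lambda>n. fst (heads C \<tau> n (X, Y) x)) n \<otimes> X n) (fst (heads C \<tau> n (X, Y) x) \<otimes> Y n)"
    if "n > 0" for n
    using that h[of n] by (cases n) auto
  ultimately show ?thesis
    using XY x h by (simp add: unfold_iSeq_def FObj_iSeq_iff del: heads.simps)
qed

text \<open>Two unitors meet their match: the one put on the first head cancels against the inverse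
  in \<open>iSeq_split\<close>, and the one that splitting adds at index 1 is the one that unfolding
  \<open>t\<close> puts on its own first head, as \<open>actO C M (tail X)\<close> begins with
  \<open>M \<otimes> X 1\<close>.\<close>

lemma iSeq_split_unfold_iSeq:
  assumes T: "Psi_coalgebra C T \<tau>" and XY: "(X, Y) \<in> Obj (bi_seq_cat C)" and x: "x \<in> FObj T (X, Y)"
    and eq: "\<tau> (X, Y) x = (M, f, t)"
  shows "iSeq_split C (X, Y) (unfold_iSeq C T \<tau> (X, Y) x) =
    (M, f, unfold_iSeq C T \<tau> (actO C M (tail X), tail Y) t)"
proof -
  have f: "f \<in> hom C (X 0) (M \<otimes> Y 0)" and t: "t \<in> FObj T (actO C M (tail X), tail Y)"
    and a': "(actO C M (tail X), tail Y) \<in> Obj (bi_seq_cat C)"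
    using Psi_coalgebra_step[OF T XY x] eq by (metis prod.inject)+
  have X: "X 0 \<in> Obj C" using XY by (simp add: Obj_bi_seq_iff)
  show ?thesis
    using unfold_iSeq_in[OF T XY x] XY x a' t Lunit_cancel[OF X f]
    by (simp add: unfold_iSeq_def iSeq_split_eq eq act_seq) (auto simp: fun_eq_iff eq)
qed

lemma unfold_iSeq_nat:
  assumes T: "Psi_coalgebra C T \<tau>" and p: "p \<in> Arr (bi_seq_cat C)"
    and x: "x \<in> FObj T (Dom (bi_seq_cat C) p)"
  shows "unfold_iSeq C T \<tau> (Cod (bi_seq_cat C) p) (FArr T p x) =
    FArr (iSeq C) p (unfold_iSeq C T \<tau> (Dom (bi_seq_cat C) p) x)"
proof -
  let ?D = "bi_seq_cat C" and ?h = "unfold_iSeq C T \<tau>"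
  \<comment> \<open>The bisimulation relates the two ways around the naturality square. It
    quantifies over the arrow and the state because both change at each step.\<close>
  define R where "R X Y y z \<longleftrightarrow> (\<exists>p x. p \<in> Arr ?D \<and> Cod ?D p = (X, Y) \<and> x \<in> FObj T (Dom ?D p) \<and>
    y = ?h (X, Y) (FArr T p x) \<and> z = FArr (iSeq C) p (?h (Dom ?D p) x))" for X Y y z
  have Tf: "set_functor ?D T" and \<tau>: "nat_trans ?D T (Psi C T) \<tau>"
    using T by (auto simp: Psi_coalgebra_def)
  obtain X' Y' where c: "Cod ?D p = (X', Y')" by (cases "Cod ?D p")
  have "R X' Y' (?h (X', Y') (FArr T p x)) (FArr (iSeq C) p (?h (Dom ?D p) x))"
    using p x c unfolding R_def by blast
  then have "?h (X', Y') (FArr T p x) = FArr (iSeq C) p (?h (Dom ?D p) x)"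
  proof (rule iSeq_coinduct)
    fix X' Y' y z assume "R X' Y' y z"
    then obtain p x where p: "p \<in> Arr ?D" and c: "Cod ?D p = (X', Y')" and x: "x \<in> FObj T (Dom ?D p)"
      and y: "y = ?h (X', Y') (FArr T p x)" and z: "z = FArr (iSeq C) p (?h (Dom ?D p) x)"
      unfolding R_def by blast
    obtain u v where uv: "p = (u, v)" by (cases p)
    obtain X Y where d: "Dom ?D p = (X, Y)" by (cases "Dom ?D p")
    have a: "u n \<in> Arr C" "v n \<in> Arr C" for n using p by (auto simp: uv bi_seq_simps)
    have XY: "(X, Y) \<in> Obj ?D" and XY': "(X', Y') \<in> Obj ?D"
      using category.Dom_Obj[OF category_bi_seq_cat p] category.Cod_Obj[OF category_bi_seq_cat p]
      by (simp_all only: c d)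
    have x1: "x \<in> FObj T (X, Y)" using x d by simp
    have x2: "FArr T p x \<in> FObj T (X', Y')"
      using Tf p x c unfolding set_functor_iff by metis
    obtain M f t where s: "\<tau> (X, Y) x = (M, f, t)" and M: "M \<in> Obj C"
      and f: "f \<in> hom C (X 0) (M \<otimes> Y 0)" and t: "t \<in> FObj T (actO C M (tail X), tail Y)"
      by (rule Psi_coalgebra_step[OF T XY x1])
    \<comment> \<open>The arrow by which \<open>Psi\<close> acts on successor states; with it the
      tails are again related by \<open>R\<close>.\<close>
    define q where "q = (actA C M (tail u), tail v)"
    have act: "actA C M (tail u) n \<in>
        hom C (actO C M (tail (\<lambda>n. Dom C (u n))) n) (actO C M (tail (\<lambda>n. Cod C (u n))) n)" for n
      by (rule actA_DC[OF M a(1)])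
    have q: "q \<in> Arr ?D" and qd: "Dom ?D q = (actO C M (tail X), tail Y)"
      and qc: "Cod ?D q = (actO C M (tail X'), tail Y')"
      using act a c d by (auto simp: q_def uv bi_seq_simps hom_iff)
    \<comment> \<open>Stated for any \<open>S\<close>, as it is applied both to \<open>T\<close> and
      to \<open>iSeq C\<close>. The action leaves \<open>M\<close> unchanged and alters the head
      independently of \<open>S\<close>, so both sides of the square split off the same
      head.\<close>
    have PT: "FArr (Psi C S) p (M, f, w) = (M, (Ide C M \<boxtimes> v 0) \<cdot> f \<cdot> u 0, FArr S q w)"
      if "w \<in> FObj S (actO C M (tail X), tail Y)" for S :: "('o, 'm, 'w) seq_profunctor" and w
      using that M f d by (simp add: Psi_def Psi_obj_def uv q_def)
    have "\<tau> (X', Y') (FArr T p x) = FArr (Psi C T) p (\<tau> (X, Y) x)"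
      using \<tau> p x unfolding nat_trans_iff c[symmetric] d[symmetric] by blast
    then have "\<tau> (X', Y') (FArr T p x) = (M, (Ide C M \<boxtimes> v 0) \<cdot> f \<cdot> u 0, FArr T q t)"
      using PT[OF t] s by simp
    note sy = iSeq_split_unfold_iSeq[OF T XY' x2 this]
    have hx: "?h (X, Y) x \<in> FObj (iSeq C) (X, Y)" by (rule unfold_iSeq_in[OF T XY x1])
    have "iSeq_split C (X', Y') z = FArr (Psi C (iSeq C)) p (iSeq_split C (X, Y) (?h (X, Y) x))"
      using iSeq_split_nat_trans p hx unfolding nat_trans_iff z c[symmetric] d[symmetric] by blast
    also have "\<dots> = (M, (Ide C M \<boxtimes> v 0) \<cdot> f \<cdot> u 0,
        FArr (iSeq C) q (?h (actO C M (tail X), tail Y) t))"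
      using PT[OF unfold_iSeq_in[OF T act_Obj[OF XY M] t]] iSeq_split_unfold_iSeq[OF T XY x1 s] by simp
    finally have sz: "iSeq_split C (X', Y') z = \<dots>" .
    have "R (actO C M (tail X')) (tail Y') (?h (actO C M (tail X'), tail Y') (FArr T q t))
        (FArr (iSeq C) q (?h (actO C M (tail X), tail Y) t))"
      unfolding R_def using q qc qd t by metis
    moreover have "z \<in> FObj (iSeq C) (X', Y')"
      using iSeq_functor p hx unfolding set_functor_iff z c[symmetric] d[symmetric] by blast
    moreover have "y \<in> FObj (iSeq C) (X', Y')"
      using unfold_iSeq_in[OF T XY' x2] y by simp
    ultimately show "(X', Y') \<in> Obj ?D \<and> y \<in> FObj (iSeq C) (X', Y') \<and> z \<in> FObj (iSeq C) (X', Y') \<and>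
      (\<exists>M f y' z'. iSeq_split C (X', Y') y = (M, f, y') \<and> iSeq_split C (X', Y') z = (M, f, z') \<and>
         R (actO C M (tail X')) (tail Y') y' z')"
      using XY' sy sz y by blast
  qed
  then show ?thesis by (simp add: c)
qed

lemma Psi_coalgebra_hom_unfold_iSeq:
  assumes T: "Psi_coalgebra C T \<tau>"
  shows "Psi_coalgebra_hom C T \<tau> (iSeq C) (iSeq_split C) (unfold_iSeq C T \<tau>)"
proof -
  have "nat_trans (bi_seq_cat C) T (iSeq C) (unfold_iSeq C T \<tau>)"
    unfolding nat_trans_iff
  proof (intro conjI ballI)
    show "unfold_iSeq C T \<tau> a \<in> extensional (FObj T a)" if "a \<in> Obj (bi_seq_cat C)" for a
      using that by (cases a) (simp add: unfold_iSeq_def)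
    show "unfold_iSeq C T \<tau> a x \<in> FObj (iSeq C) a"
      if "a \<in> Obj (bi_seq_cat C)" "x \<in> FObj T a" for a x
      using that unfold_iSeq_in[OF T] by (cases a) auto
    show "unfold_iSeq C T \<tau> \<in> extensional (Obj (bi_seq_cat C))"
      by (simp add: unfold_iSeq_def)
  qed (rule unfold_iSeq_nat[OF T])
  then show ?thesis
    unfolding Psi_coalgebra_hom_iff[OF T] using iSeq_split_unfold_iSeq[OF T] by blast
qed

text \<open>The images of one state under two morphisms are bisimilar: both split into the head
  given by \<open>\<tau>\<close> and the images of the same successor.\<close>

lemma Psi_coalgebra_hom_iSeq_unique:
  assumes T: "Psi_coalgebra C T \<tau>"
    and h: "Psi_coalgebra_hom C T \<tau> (iSeq C) (iSeq_split C) h"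
    and k: "Psi_coalgebra_hom C T \<tau> (iSeq C) (iSeq_split C) k"
  shows "h = k"
proof -
  note H = h[unfolded Psi_coalgebra_hom_iff[OF T]] and K = k[unfolded Psi_coalgebra_hom_iff[OF T]]
  define R where "R X Y y z \<longleftrightarrow> (X, Y) \<in> Obj (bi_seq_cat C) \<and>
    (\<exists>x\<in>FObj T (X, Y). y = h (X, Y) x \<and> z = k (X, Y) x)" for X Y y z
  have eq: "h (X, Y) x = k (X, Y) x"
    if "(X, Y) \<in> Obj (bi_seq_cat C)" "x \<in> FObj T (X, Y)" for X Y x
  proof (rule iSeq_coinduct[of R])
    show "R X Y (h (X, Y) x) (k (X, Y) x)" using that by (auto simp: R_def)
    fix X Y y z assume "R X Y y z"
    then obtain x where XY: "(X, Y) \<in> Obj (bi_seq_cat C)" and x: "x \<in> FObj T (X, Y)"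
      and yz: "y = h (X, Y) x" "z = k (X, Y) x" by (auto simp: R_def)
    obtain M f t where s: "\<tau> (X, Y) x = (M, f, t)" "t \<in> FObj T (actO C M (tail X), tail Y)"
      "(actO C M (tail X), tail Y) \<in> Obj (bi_seq_cat C)"
      by (rule Psi_coalgebra_step[OF T XY x])
    have "R (actO C M (tail X)) (tail Y)
        (h (actO C M (tail X), tail Y) t) (k (actO C M (tail X), tail Y) t)"
      using s by (auto simp: R_def)
    moreover have "iSeq_split C (X, Y) y = (M, f, h (actO C M (tail X), tail Y) t)"
      "iSeq_split C (X, Y) z = (M, f, k (actO C M (tail X), tail Y) t)"
      using H K XY x s(1) unfolding yz by blast+
    moreover have "y \<in> FObj (iSeq C) (X, Y)" "z \<in> FObj (iSeq C) (X, Y)"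
      using H K XY x unfolding yz nat_trans_iff by blast+
    ultimately show "(X, Y) \<in> Obj (bi_seq_cat C) \<and>
      y \<in> FObj (iSeq C) (X, Y) \<and> z \<in> FObj (iSeq C) (X, Y) \<and>
      (\<exists>M f y' z'. iSeq_split C (X, Y) y = (M, f, y') \<and> iSeq_split C (X, Y) z = (M, f, z') \<and>
         R (actO C M (tail X)) (tail Y) y' z')"
      using XY by blast
  qed
  \<comment> \<open>Agreement on elements becomes equality of families because both are extensional,
    in each component and over the objects.\<close>
  have "h a = k a" if "a \<in> Obj (bi_seq_cat C)" for a
    using H K that eq unfolding nat_trans_iff
    by (cases a) (auto intro!: extensionalityI[of _ "FObj T a"])
  then show ?thesis
    using H K unfolding nat_trans_iff by (auto intro: extensionalityI)
qed

lemma final_Psi_coalgebra_iSeq: "final_Psi_coalgebra TYPE('e) C (iSeq C) (iSeq_split C)"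
  unfolding final_Psi_coalgebra_def
  using Psi_coalgebra_iSeq Psi_coalgebra_hom_unfold_iSeq Psi_coalgebra_hom_iSeq_unique by blast

text \<open>Final objects are isomorphic. As finality refers to one universe at a time, each
  coalgebra is tested against its own universe, to identify its endomorphisms, and against that of
  the other, to obtain the morphism between them.\<close>

lemma final_Psi_coalgebra_unique:
  fixes S :: "('o, 'm, 's) seq_profunctor" and R :: "('o, 'm, 'r) seq_profunctor"
  assumes Ss: "final_Psi_coalgebra TYPE('s) C S \<sigma>" and Sr: "final_Psi_coalgebra TYPE('r) C S \<sigma>"
    and Rs: "final_Psi_coalgebra TYPE('s) C R \<rho>" and Rr: "final_Psi_coalgebra TYPE('r) C R \<rho>"
  shows "\<exists>h. Psi_coalgebra_hom C S \<sigma> R \<rho> h \<and> nat_iso (bi_seq_cat C) S R h"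
proof -
  have S: "Psi_coalgebra C S \<sigma>" and R: "Psi_coalgebra C R \<rho>"
    using Ss Rs by (auto simp: final_Psi_coalgebra_def)
  obtain h where h: "Psi_coalgebra_hom C S \<sigma> R \<rho> h"
    using Rs S unfolding final_Psi_coalgebra_def by blast
  obtain k where k: "Psi_coalgebra_hom C R \<rho> S \<sigma> k"
    using Sr R unfolding final_Psi_coalgebra_def by blast
  \<comment> \<open>The composite and the identity are both coalgebra endomorphisms of
    \<open>S\<close>, and finality allows only one.\<close>
  have "nat_comp (bi_seq_cat C) S k h = nat_id (bi_seq_cat C) S"
    using Ss S Psi_coalgebra_hom_comp[OF S R h k] Psi_coalgebra_hom_id[OF S]
    unfolding final_Psi_coalgebra_def by blast
  moreover have "nat_comp (bi_seq_cat C) R h k = nat_id (bi_seq_cat C) R"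
    using Rr R Psi_coalgebra_hom_comp[OF R S k h] Psi_coalgebra_hom_id[OF R]
    unfolding final_Psi_coalgebra_def by blast
  ultimately show ?thesis
    using h k unfolding nat_iso_def Psi_coalgebra_hom_def by blast
qed

end

text \<open>In the last conjunct \<open>S\<close> stands for the intensional monoidal streams,
  characterized only by finality, against its own universe and that of \<open>iSeq\<close>.\<close>

theorem theorem3p5:
  fixes C :: "('o, 'm) smcat"
  assumes "symmetric_monoidal_category C"
  shows "Psi_fixpoint C (iSeq C) (iSeq_split C) \<and>
    final_Psi_coalgebra TYPE('e) C (iSeq C) (iSeq_split C) \<and>
    (\<forall>(S :: ('o, 'm, 's) seq_profunctor) \<sigma>.
       final_Psi_coalgebra TYPE('s) C S \<sigma> \<and>
       final_Psi_coalgebra TYPE((nat \<Rightarrow> 'o) \<times> (nat \<Rightarrow> 'm)) C S \<sigma> \<longrightarrow>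
       (\<exists>h. Psi_coalgebra_hom C S \<sigma> (iSeq C) (iSeq_split C) h \<and>
            nat_iso (bi_seq_cat C) S (iSeq C) h))"
proof -
  interpret symmetric_monoidal_category C by fact
  show ?thesis
    using Psi_fixpoint_iSeq final_Psi_coalgebra_iSeq
      final_Psi_coalgebra_unique[OF _ _ final_Psi_coalgebra_iSeq final_Psi_coalgebra_iSeq]
    by blast
qed

end
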